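(* Let $\mathcal H$ be a Hilbert space and let $\mathcal W=((W_i,c_i))_{i\in I}$ be a fusion frame for $\mathcal H$. The notion of fusion frame dual (FF-dual) has the following properties. (D1) FF-duals allow for reconstructing $x\in\mathcal H$ from the measurements $(c_iP_{W_i}x)_{i\in I}$: if $\mathcal V=((V_i,d_i))_{i\in I}$ is an FF-dual of $\mathcal W$ with associated operators $(Q_i)_{i\in I}$ as in the definition of FF-dual, then $x=\sum_{i\in I}d_iP_{V_i}Q_i(c_iP_{W_i}x)$ for all $x\in\mathcal H$. (D2a) If $(\psi_i)_{i\in I}$ is a dual frame of the (vector) frame $(\varphi_i)_{i\in I}$ for $\mathcal H$, then $((\operatorname{span}\{\psi_i\},\|\psi_i\|))_{i\in I}$ is an FF-dual of $((\operatorname{span}\{\varphi_i\},\|\varphi_i\|))_{i\in I}$. (D2b) If $\dim W_i\in\{0,1\}$ for each $i\in I$ and $\mathcal V=((V_i,d_i))_{i\in I}$ is an FF-dual of $\mathcal W$ with $\dim V_i\in\{0,1\}$ for each $i\in I$, then there exist vectors $\varphi_i\in W_i$ and $\psi_i\in V_i$ with $\|\varphi_i\|=c_i$ and $\|\psi_i\|=d_i$, $i\in I$, such that $(\psi_i)_{i\in I}$ is a dual frame of $(\varphi_i)_{i\in I}$. (D3) If $\mathcal V$ is an FF-dual of $\mathcal W$, then $\mathcal V$ is itself a fusion frame for $\mathcal H$ and $\mathcal W$ is an FF-dual of $\mathcal V$. (D4) The fusion sequence $((S_{\mathcal W}^{-1}W_i,\ c_i\|S_{\mathcal W}^{-1}|W_i\|))_{i\in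 I}$ is an FF-dual of $\mathcal W$.
   Context: $I\subset\mathbb N$ is a finite or countable index set, $\mathcal B(\mathcal H)$ denotes the bounded operators on $\mathcal H$, and $P_V$ the orthogonal projection onto a closed subspace $V$. A fusion sequence is a sequence of pairs $\mathcal W=((W_i,c_i))_{i\in I}$ of closed subspaces $W_i\subset\mathcal H$ and real numbers $c_i\ge0$ such that $W_i=\{0\}\Leftrightarrow c_i=0$. It is a Bessel fusion sequence if there is $\beta>0$ with $\sum_{i\in I}c_i^2\|P_{W_i}x\|^2\le\beta\|x\|^2$ for all $x\in\mathcal H$, and a fusion frame for $\mathcal H$ if there are $\alpha,\beta>0$ with $\alpha\|x\|^2\le\sum_{i\in I}c_i^2\|P_{W_i}x\|^2\le\beta\|x\|^2$ for all $x\in\mathcal H$. The analysis operator of a Bessel fusion sequence is $T_{\mathcal W}:\mathcal H\to\ell^2(I,\mathcal H)$, $T_{\mathcal W}x=(c_iP_{W_i}x)_{i\in I}$, and $S_{\mathcal W}:=T_{\mathcal W}^*T_{\mathcal W}$, which is boundedly invertible for a fusion frame. $S_{\mathcal W}^{-1}|W_i$ is the restriction to $W_i$. For fusion sequences $\mathcal V=((V_i,d_i))_{i\in I}$, $\mathcal W=((W_i,c_i))_{i\in I}$ put $I_0(\mathcal V,\mathcal W):=\{i\in I: V_i=\{0\}\text{ or }W_i=\{0\}\}$. A Bessel fusion sequence $\mathcal V=((V_i,d_i))_{i\in I}$ is a fusion frame dual (FF-dual) of the fusion frame $\mathcal W=((W_i,c_i))_{i\in I}$ if there exists a sequence $(Q_i)_{i\in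 I}\subset\mathcal B(\mathcal H)$ such that for each $i\in I$: $W_i^\perp\subset\ker Q_i$, $\operatorname{ran}Q_i\subset V_i$, and $\|Q_i\|=1$ if $i\notin I_0(\mathcal V,\mathcal W)$; and $x=\sum_{i\in I}c_id_iQ_ix$ for all $x\in\mathcal H$. A (vector) frame for $\mathcal H$ is a sequence $(\varphi_i)_{i\in I}\subset\mathcal H$ with $\alpha\|x\|^2\le\sum_{i\in I}|\langle x,\varphi_i\rangle|^2\le\beta\|x\|^2$ for all $x\in\mathcal H$ and some $\alpha,\beta>0$; a dual frame of it is a sequence $(\psi_i)_{i\in I}\subset\mathcal H$ with the Bessel property ($\sum_{i\in I}|\langle x,\psi_i\rangle|^2\le\beta'\|x\|^2$ for all $x$ and some $\beta'>0$) and $\sum_{i\in I}\langle x,\varphi_i\rangle\psi_i=x$ for all $x\in\mathcal H$. *)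

theory Defs
  imports "HOL-Analysis.Analysis"
begin

text \<open>
  The scalar field is \<open>\<real>\<close> or \<open>\<complex>\<close>.  Up to isometric isomorphism these are the only instances of
  \<open>rc_field\<close>: additivity of \<open>conjg\<close> and \<open>x * conjg x = \<bar>x\<bar>\<^sup>2\<close> force \<open>x + conjg x\<close> to be real, so
  every \<open>x\<close> is a root of a real quadratic polynomial.
\<close>

class rc_field = real_normed_field +
  fixes conjg :: "'a \<Rightarrow> 'a"
  assumes conjg_add: "conjg (x + y) = conjg x + conjg y"
    and conjg_mult: "conjg (x * y) = conjg x * conjg y"
    and mult_conjg: "x * conjg x = (norm x)\<^sup>2 *\<^sub>R 1"

instantiation real :: rc_field
begin
definition conjg_real :: "real \<Rightarrow> real" where "conjg_real x = x"
instance by standard (simp_all add: conjg_real_def power2_eq_square)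
end

instantiation complex :: rc_field
begin
definition conjg_complex :: "complex \<Rightarrow> complex" where "conjg_complex = cnj"
instance by standard (simp_all only: conjg_complex_def complex_cnj_add complex_cnj_mult
      complex_norm_square[symmetric] scaleR_conv_of_real mult_1_right)
end

text \<open>
  A Hilbert space over \<open>'k\<close> whose underlying real Banach space is the type \<open>'a\<close>.  The inner
  product \<open>ip\<close> is linear in its first argument and induces the norm of \<open>'a\<close>.
\<close>

locale hilbert_space = vector_space scale
  for scale :: "'k::rc_field \<Rightarrow> 'a::banach \<Rightarrow> 'a" +
  fixes ip :: "'a \<Rightarrow> 'a \<Rightarrow> 'k"
  assumes scale_of_real: "scale (of_real r) x = r *\<^sub>R x"
    and ip_commute: "ip x y = conjg (ip y x)"
    and ip_add_left: "ip (x + y) z = ip x z + ip y z"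
    and ip_scale_left: "ip (scale a x) y = a * ip x y"
    and ip_self: "ip x x = of_real ((norm x)\<^sup>2)"

lemma hilbert_space_real:
  "hilbert_space (scaleR :: real \<Rightarrow> 'a::{real_inner,banach} \<Rightarrow> 'a) inner"
  by unfold_locales
    (simp_all add: conjg_real_def inner_commute inner_add_left inner_add_right power2_norm_eq_inner
      scaleR_add_right scaleR_add_left)

lemma hilbert_space_complex:
  "hilbert_space ((*) :: complex \<Rightarrow> complex \<Rightarrow> complex) (\<lambda>x y. x * cnj y)"
  by unfold_locales
    (simp_all add: conjg_complex_def complex_norm_square algebra_simps scaleR_conv_of_real
      del: of_real_power)

definition onorm_on :: "('a::real_normed_vector \<Rightarrow> 'b::real_normed_vector) \<Rightarrow> 'a set \<Rightarrow> real" where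
  "onorm_on A W = (SUP x\<in>W. norm (A x) / norm x)"

context hilbert_space
begin

definition closed_subspace :: "'a set \<Rightarrow> bool" where
  "closed_subspace W \<longleftrightarrow> subspace W \<and> closed W"

definition orth_compl :: "'a set \<Rightarrow> 'a set" where
  "orth_compl W = {x. \<forall>w\<in>W. ip x w = 0}"

definition proj :: "'a set \<Rightarrow> 'a \<Rightarrow> 'a" where
  "proj W x = (THE p. p \<in> W \<and> x - p \<in> orth_compl W)"

definition bounded_op :: "('a \<Rightarrow> 'a) \<Rightarrow> bool" where
  "bounded_op Q \<longleftrightarrow> Vector_Spaces.linear scale scale Q \<and> (\<exists>K. \<forall>x. norm (Q x) \<le> norm x * K)"

text \<open>Needed next to \<open>dim\<close>, which takes the value 0 on infinite-dimensional subspaces.\<close>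

definition finite_dim :: "'a set \<Rightarrow> bool" where
  "finite_dim V \<longleftrightarrow> (\<exists>B. finite B \<and> V \<subseteq> span B)"

text \<open>
  A sequence of pairs \<open>((W\<^sub>i, c\<^sub>i))\<^sub>i\<^sub>\<in>\<^sub>I\<close> is given by the two functions \<open>W\<close> and \<open>c\<close>, of which only the
  values on \<open>I\<close> matter.  Sums over \<open>I\<close> are unconditional (\<open>has_sum\<close>).  For the reconstruction
  formulas below this agrees with convergence in the order of \<open>\<nat>\<close>, because the Bessel conditions
  on both sequences already make these series converge unconditionally.
\<close>

definition fusion_sequence :: "nat set \<Rightarrow> (nat \<Rightarrow> 'a set) \<Rightarrow> (nat \<Rightarrow> real) \<Rightarrow> bool" where
  "fusion_sequence I W c \<longleftrightarrow>
    (\<forall>i\<in>I. closed_subspace (W i) \<and> c i \<ge> 0 \<and> (W i = {0} \<longleftrightarrow> c i = 0))"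

definition bessel_fusion_sequence :: "nat set \<Rightarrow> (nat \<Rightarrow> 'a set) \<Rightarrow> (nat \<Rightarrow> real) \<Rightarrow> bool" where
  "bessel_fusion_sequence I W c \<longleftrightarrow> fusion_sequence I W c \<and>
    (\<exists>\<beta>>0. \<forall>x. (\<lambda>i. (c i)\<^sup>2 * (norm (proj (W i) x))\<^sup>2) summable_on I \<and>
      (\<Sum>\<^sub>\<infinity>i\<in>I. (c i)\<^sup>2 * (norm (proj (W i) x))\<^sup>2) \<le> \<beta> * (norm x)\<^sup>2)"

definition fusion_frame :: "nat set \<Rightarrow> (nat \<Rightarrow> 'a set) \<Rightarrow> (nat \<Rightarrow> real) \<Rightarrow> bool" where
  "fusion_frame I W c \<longleftrightarrow> fusion_sequence I W c \<and>
    (\<exists>\<alpha>>0. \<exists>\<beta>>0. \<forall>x. (\<lambda>i. (c i)\<^sup>2 * (norm (proj (W i) x))\<^sup>2) summable_on I \<and>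
      \<alpha> * (norm x)\<^sup>2 \<le> (\<Sum>\<^sub>\<infinity>i\<in>I. (c i)\<^sup>2 * (norm (proj (W i) x))\<^sup>2) \<and>
      (\<Sum>\<^sub>\<infinity>i\<in>I. (c i)\<^sup>2 * (norm (proj (W i) x))\<^sup>2) \<le> \<beta> * (norm x)\<^sup>2)"

text \<open>
  Elements of \<open>\<ell>\<^sup>2(I, H)\<close> are functions \<open>nat \<Rightarrow> 'a\<close> that vanish outside \<open>I\<close> and are square-summable
  on \<open>I\<close>; \<open>ell2_ip\<close> is the inner product of that space, and \<open>ell2_adjoint I T\<close> is the adjoint
  \<open>T\<^sup>* : \<ell>\<^sup>2(I, H) \<rightarrow> H\<close> of a bounded operator \<open>T : H \<rightarrow> \<ell>\<^sup>2(I, H)\<close>.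
\<close>

definition ell2_ip :: "nat set \<Rightarrow> (nat \<Rightarrow> 'a) \<Rightarrow> (nat \<Rightarrow> 'a) \<Rightarrow> 'k" where
  "ell2_ip I a b = (\<Sum>\<^sub>\<infinity>i\<in>I. ip (a i) (b i))"

definition ell2_adjoint :: "nat set \<Rightarrow> ('a \<Rightarrow> nat \<Rightarrow> 'a) \<Rightarrow> (nat \<Rightarrow> 'a) \<Rightarrow> 'a" where
  "ell2_adjoint I T a = (THE z. \<forall>x. ip x z = ell2_ip I (T x) a)"

definition analysis_op :: "nat set \<Rightarrow> (nat \<Rightarrow> 'a set) \<Rightarrow> (nat \<Rightarrow> real) \<Rightarrow> 'a \<Rightarrow> nat \<Rightarrow> 'a" where
  "analysis_op I W c x = (\<lambda>i. if i \<in> I then c i *\<^sub>R proj (W i) x else 0)"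

definition fusion_frame_op :: "nat set \<Rightarrow> (nat \<Rightarrow> 'a set) \<Rightarrow> (nat \<Rightarrow> real) \<Rightarrow> 'a \<Rightarrow> 'a" where
  "fusion_frame_op I W c = ell2_adjoint I (analysis_op I W c) \<circ> analysis_op I W c"

definition null_indices :: "nat set \<Rightarrow> (nat \<Rightarrow> 'a set) \<Rightarrow> (nat \<Rightarrow> 'a set) \<Rightarrow> nat set" where
  "null_indices I V W = {i \<in> I. V i = {0} \<or> W i = {0}}"

definition ff_dual_ops :: "nat set \<Rightarrow> (nat \<Rightarrow> 'a set) \<Rightarrow> (nat \<Rightarrow> real) \<Rightarrow>
    (nat \<Rightarrow> 'a set) \<Rightarrow> (nat \<Rightarrow> real) \<Rightarrow> (nat \<Rightarrow> 'a \<Rightarrow> 'a) \<Rightarrow> bool" where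
  "ff_dual_ops I V d W c Q \<longleftrightarrow>
    (\<forall>i\<in>I. bounded_op (Q i) \<and> orth_compl (W i) \<subseteq> {x. Q i x = 0} \<and> range (Q i) \<subseteq> V i \<and>
      (i \<notin> null_indices I V W \<longrightarrow> onorm (Q i) = 1)) \<and>
    (\<forall>x. ((\<lambda>i. (c i * d i) *\<^sub>R Q i x) has_sum x) I)"

text \<open>\<open>ff_dual I V d W c\<close>: \<open>((V\<^sub>i, d\<^sub>i))\<^sub>i\<^sub>\<in>\<^sub>I\<close> is an FF-dual of the fusion frame \<open>((W\<^sub>i, c\<^sub>i))\<^sub>i\<^sub>\<in>\<^sub>I\<close>.\<close>

definition ff_dual :: "nat set \<Rightarrow> (nat \<Rightarrow> 'a set) \<Rightarrow> (nat \<Rightarrow> real) \<Rightarrow>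
    (nat \<Rightarrow> 'a set) \<Rightarrow> (nat \<Rightarrow> real) \<Rightarrow> bool" where
  "ff_dual I V d W c \<longleftrightarrow> fusion_frame I W c \<and> bessel_fusion_sequence I V d \<and>
    (\<exists>Q. ff_dual_ops I V d W c Q)"

definition vector_frame :: "nat set \<Rightarrow> (nat \<Rightarrow> 'a) \<Rightarrow> bool" where
  "vector_frame I \<phi> \<longleftrightarrow>
    (\<exists>\<alpha>>0. \<exists>\<beta>>0. \<forall>x. (\<lambda>i. (norm (ip x (\<phi> i)))\<^sup>2) summable_on I \<and>
      \<alpha> * (norm x)\<^sup>2 \<le> (\<Sum>\<^sub>\<infinity>i\<in>I. (norm (ip x (\<phi> i)))\<^sup>2) \<and>
      (\<Sum>\<^sub>\<infinity>i\<in>I. (norm (ip x (\<phi> i)))\<^sup>2) \<le> \<beta> * (norm x)\<^sup>2)"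

definition bessel_sequence :: "nat set \<Rightarrow> (nat \<Rightarrow> 'a) \<Rightarrow> bool" where
  "bessel_sequence I \<psi> \<longleftrightarrow>
    (\<exists>\<beta>>0. \<forall>x. (\<lambda>i. (norm (ip x (\<psi> i)))\<^sup>2) summable_on I \<and>
      (\<Sum>\<^sub>\<infinity>i\<in>I. (norm (ip x (\<psi> i)))\<^sup>2) \<le> \<beta> * (norm x)\<^sup>2)"

text \<open>\<open>dual_frame I \<psi> \<phi>\<close>: \<open>\<psi>\<close> is a dual frame of the frame \<open>\<phi>\<close>.\<close>

definition dual_frame :: "nat set \<Rightarrow> (nat \<Rightarrow> 'a) \<Rightarrow> (nat \<Rightarrow> 'a) \<Rightarrow> bool" where
  "dual_frame I \<psi> \<phi> \<longleftrightarrow> vector_frame I \<phi> \<and> bessel_sequence I \<psi> \<and>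
    (\<forall>x. ((\<lambda>i. scale (ip x (\<phi> i)) (\<psi> i)) has_sum x) I)"

end

end

theory Submission
  imports Defs
begin

text \<open>
  The Bessel condition on \<open>\<W>\<close> makes the synthesis operator \<open>(a\<^sub>i) \<mapsto> \<Sum> c\<^sub>i P\<^bsub>W\<^sub>i\<^esub> a\<^sub>i\<close> bounded on
  square-summable sequences, with unconditional convergence.
  Hence for an FF-dual with operators \<open>Q\<^sub>i\<close> the series \<open>\<Sum> c\<^sub>i d\<^sub>i Q\<^sub>i\<^sup>* x\<close> converges, and testing it against
  vectors shows that its value is \<open>x\<close>: the adjoints witness the symmetry of the duality relation.
  Cauchy--Schwarz applied to \<open>\<parallel>x\<parallel>\<^sup>2 = \<Sum> c\<^sub>i d\<^sub>i \<langle>Q\<^sub>i P\<^bsub>W\<^sub>i\<^esub> x, P\<^bsub>V\<^sub>i\<^esub> x\<rangle>\<close> yields the lower frame bound of the dual.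
  For one-dimensional subspaces the \<open>Q\<^sub>i\<close> have rank one, which translates FF-duals into dual frames
  and back; the canonical dual uses \<open>Q\<^sub>i = S\<^sup>-\<^sup>1 P\<^bsub>W\<^sub>i\<^esub> / \<parallel>S\<^sup>-\<^sup>1|W\<^sub>i\<parallel>\<close>.
\<close>

section \<open>Unconditional summation\<close>

text \<open>Cauchy criterion for the net of finite partial sums. Two finite index sets containing
  \<open>F0\<close> have partial sums within \<open>e / 2\<close> of \<open>sum f F0\<close>, hence
  within \<open>e\<close> of each other, and completeness supplies the limit.\<close>

lemma summable_on_if_small_tails:
  fixes f :: "'i \<Rightarrow> 'b::banach"
  assumes tails: "\<And>e. e > 0 \<Longrightarrow> \<exists>F0. finite F0 \<and> F0 \<subseteq> A \<and>
    (\<forall>F. finite F \<and> F \<subseteq> A - F0 \<longrightarrow> norm (sum f F) < e)"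
  shows "f summable_on A"
proof -
  have "\<exists>P. eventually P (finite_subsets_at_top A) \<and>
      (\<forall>F F'. P F \<and> P F' \<longrightarrow> dist (sum f F) (sum f F') < e)" if "e > 0" for e
  proof -
    obtain F0 where F0: "finite F0" "F0 \<subseteq> A"
      and small: "\<And>F. finite F \<Longrightarrow> F \<subseteq> A - F0 \<Longrightarrow> norm (sum f F) < e / 2"
      using tails[of "e / 2"] \<open>e > 0\<close> by auto
    let ?P = "\<lambda>F. finite F \<and> F0 \<subseteq> F \<and> F \<subseteq> A"
    have "eventually ?P (finite_subsets_at_top A)"
      using F0 by (auto simp: eventually_finite_subsets_at_top)
    moreover have "dist (sum f F) (sum f F') < e" if "?P F" "?P F'" for F F'
    proof -
      have near: "norm (sum f G - sum f F0) < e / 2" if "?P G" for G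
        using small[of "G - F0"] that by (simp add: sum_diff Diff_mono)
      have "dist (sum f F) (sum f F') \<le> norm (sum f F - sum f F0) + norm (sum f F' - sum f F0)"
        using norm_triangle_ineq4[of "sum f F - sum f F0" "sum f F' - sum f F0"]
        by (simp add: dist_norm)
      then show ?thesis
        using near[OF that(1)] near[OF that(2)] by linarith
    qed
    ultimately show ?thesis
      by (intro exI[of _ ?P] conjI allI impI) (simp_all only:)
  qed
  then have "cauchy_filter (filtermap (sum f) (finite_subsets_at_top A))"
    unfolding cauchy_filter_metric_filtermap by (intro allI impI)
  moreover have "complete (UNIV::'b set)"
    by (meson Cauchy_convergent UNIV_I complete_def convergent_def)
  ultimately obtain L where "(sum f \<longlongrightarrow> L) (finite_subsets_at_top A)"
    using complete_uniform[where S=UNIV] by (force simp add: filterlim_def)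
  then show ?thesis
    using summable_on_def has_sum_def by blast
qed

text \<open>Tails of \<open>g\<close> control tails of \<open>f\<close>: once \<open>F0\<close>
  captures the sum of \<open>g\<close> up to \<open>e\<^sup>2 / (2 * B)\<close>, every finite block
  outside \<open>F0\<close> has a partial sum of \<open>f\<close> with square at most
  \<open>e\<^sup>2 / 2\<close>.\<close>

lemma summable_on_if_square_bound:
  fixes f :: "'i \<Rightarrow> 'b::banach" and g :: "'i \<Rightarrow> real"
  assumes g: "g summable_on A" and B: "B > 0"
    and bound: "\<And>F. finite F \<Longrightarrow> F \<subseteq> A \<Longrightarrow> (norm (sum f F))\<^sup>2 \<le> B * sum g F"
  shows "f summable_on A"
proof (rule summable_on_if_small_tails)
  fix e :: real assume "e > 0"
  then have pos: "e\<^sup>2 / (2 * B) > 0" using B by simp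
  \<comment> \<open>The bound on singletons already forces the sign of \<open>g\<close>.\<close>
  have g_nonneg: "g i \<ge> 0" if "i \<in> A" for i
  proof -
    have "0 \<le> B * g i"
      using order_trans[OF zero_le_power2 bound[of "{i}"]] that by simp
    then show ?thesis using B by (simp add: zero_le_mult_iff)
  qed
  obtain F0 where F0: "finite F0" "F0 \<subseteq> A" "dist (sum g F0) (infsum g A) \<le> e\<^sup>2 / (2 * B)"
    using infsum_finite_approximation[OF g pos] by blast
  have "norm (sum f F) < e" if F: "finite F" "F \<subseteq> A - F0" for F
  proof -
    have "sum g (F0 \<union> F) \<le> infsum g A"
      using F F0 g_nonneg by (intro finite_sum_le_infsum[OF g]) auto
    moreover have "sum g (F0 \<union> F) = sum g F0 + sum g F"
      using F F0 by (intro sum.union_disjoint) auto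
    ultimately have "sum g F \<le> e\<^sup>2 / (2 * B)"
      using F0(3) by (simp add: dist_real_def)
    then have "B * sum g F \<le> e\<^sup>2 / 2"
      using B by (simp add: field_simps)
    moreover have "(norm (sum f F))\<^sup>2 \<le> B * sum g F"
      using F by (intro bound) auto
    ultimately have "(norm (sum f F))\<^sup>2 < e\<^sup>2"
      using \<open>e > 0\<close> by (smt (verit) field_sum_of_halves zero_less_power)
    then show ?thesis
      using \<open>e > 0\<close> by (simp add: power_less_imp_less_base)
  qed
  then show "\<exists>F0. finite F0 \<and> F0 \<subseteq> A \<and> (\<forall>F. finite F \<and> F \<subseteq> A - F0 \<longrightarrow> norm (sum f F) < e)"
    using F0 by blast
qed

lemma has_sum_norm_le_partial_bound:
  fixes f :: "'i \<Rightarrow> 'b::real_normed_vector"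
  assumes s: "(f has_sum s) A"
    and bound: "\<And>F. finite F \<Longrightarrow> F \<subseteq> A \<Longrightarrow> norm (sum f F) \<le> B"
  shows "norm s \<le> B"
proof (rule tendsto_upperbound)
  show "((\<lambda>F. norm (sum f F)) \<longlongrightarrow> norm s) (finite_subsets_at_top A)"
    using s unfolding has_sum_def by (rule tendsto_norm)
  show "\<forall>\<^sub>F F in finite_subsets_at_top A. norm (sum f F) \<le> B"
    using bound by (intro eventually_finite_subsets_at_top_weakI)
qed simp

text \<open>The finite Cauchy-Schwarz inequality bounds all partial sums uniformly, and the bound
  passes to the limit. It serves both for the lower frame bound of a dual and for the boundedness of
  the frame operator.\<close>

lemma has_sum_Cauchy_Schwarz:
  fixes f :: "'i \<Rightarrow> 'b::real_normed_vector" and u v :: "'i \<Rightarrow> real"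
  assumes s: "(f has_sum s) A"
    and f: "\<And>i. i \<in> A \<Longrightarrow> norm (f i) \<le> u i * v i"
    and u: "(\<lambda>i. (u i)\<^sup>2) summable_on A" and v: "(\<lambda>i. (v i)\<^sup>2) summable_on A"
  shows "(norm s)\<^sup>2 \<le> (\<Sum>\<^sub>\<infinity>i\<in>A. (u i)\<^sup>2) * (\<Sum>\<^sub>\<infinity>i\<in>A. (v i)\<^sup>2)"
proof -
  let ?B = "(\<Sum>\<^sub>\<infinity>i\<in>A. (u i)\<^sup>2) * (\<Sum>\<^sub>\<infinity>i\<in>A. (v i)\<^sup>2)"
  have "norm s \<le> sqrt ?B"
  proof (rule has_sum_norm_le_partial_bound[OF s])
    fix F assume F: "finite F" "F \<subseteq> A"
    have "norm (sum f F) \<le> (\<Sum>i\<in>F. u i * v i)"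
      using F f by (intro sum_norm_le) auto
    moreover have "(\<Sum>i\<in>F. u i * v i)\<^sup>2 \<le> (\<Sum>i\<in>F. (u i)\<^sup>2) * (\<Sum>i\<in>F. (v i)\<^sup>2)"
      by (rule Cauchy_Schwarz_ineq_sum)
    moreover have "\<dots> \<le> ?B"
      using F by (intro mult_mono finite_sum_le_infsum u v infsum_nonneg sum_nonneg) auto
    ultimately show "norm (sum f F) \<le> sqrt ?B"
      by (smt (verit) real_le_rsqrt)
  qed
  moreover have "?B \<ge> 0"
    by (intro mult_nonneg_nonneg infsum_nonneg) auto
  ultimately show ?thesis
    by (metis norm_ge_zero power_mono real_sqrt_pow2)
qed

section \<open>Hilbert space geometry\<close>

lemma conjg_zero [simp]: "conjg (0::'k::rc_field) = 0"
  using conjg_add[of "0::'k" 0] by simp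

lemma mult_conjg_of_real: "x * conjg (x::'k::rc_field) = of_real ((norm x)\<^sup>2)"
  using mult_conjg[of x] by (simp add: of_real_def)

lemma conjg_of_real [simp]: "conjg (of_real r :: 'k::rc_field) = of_real r"
proof (cases "r = 0")
  case False
  then show ?thesis
    using mult_conjg_of_real[of "of_real r :: 'k"] by (simp add: power2_eq_square)
qed simp

text \<open>The product \<open>x * conjg x\<close> is a real scalar and so is fixed by
  \<open>conjg\<close>; expanding multiplicatively and cancelling the nonzero factor
  \<open>conjg x\<close> gives the involution.\<close>

lemma conjg_conjg [simp]: "conjg (conjg x) = (x::'k::rc_field)"
proof (cases "x = 0")
  case False
  have "conjg (x * conjg x) = x * conjg x"
    by (simp only: mult_conjg_of_real conjg_of_real)
  then have "conjg x * conjg (conjg x) = conjg x * x"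
    by (simp add: conjg_mult mult.commute)
  moreover have "conjg x \<noteq> 0"
    using False mult_conjg_of_real[of x] by auto
  ultimately show ?thesis by simp
qed simp

lemma norm_conjg [simp]: "norm (conjg x) = norm (x::'k::rc_field)"
proof (cases "x = 0")
  case False
  have "norm (x * conjg x) = (norm x)\<^sup>2"
    by (simp add: mult_conjg_of_real norm_power)
  then show ?thesis using False by (simp add: norm_mult power2_eq_square)
qed simp

context hilbert_space
begin

section \<open>Calculus of the inner product\<close>

lemma ip_zero_left [simp]: "ip 0 y = 0"
  using ip_add_left[of 0 0 y] by simp

lemma ip_zero_right [simp]: "ip x 0 = 0"
  using ip_commute[of x 0] by simp

lemma ip_add_right: "ip x (y + z) = ip x y + ip x z"
  by (simp only: ip_commute[of x "y + z"] ip_commute[of x y] ip_commute[of x z] ip_add_left conjg_add)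

lemma ip_scale_right: "ip x (scale a y) = conjg a * ip x y"
  by (simp only: ip_commute[of x "scale a y"] ip_commute[of x y] ip_scale_left conjg_mult)

lemma ip_minus_left: "ip (- x) y = - ip x y"
  using ip_add_left[of x "- x" y] by (simp add: add_eq_0_iff)

lemma ip_minus_right: "ip x (- y) = - ip x y"
  using ip_add_right[of x y "- y"] by (simp add: add_eq_0_iff)

lemma ip_diff_left: "ip (x - y) z = ip x z - ip y z"
  using ip_add_left[of x "- y" z] by (simp add: ip_minus_left)

lemma ip_diff_right: "ip x (y - z) = ip x y - ip x z"
  using ip_add_right[of x y "- z"] by (simp add: ip_minus_right)

lemma ip_scaleR_left: "ip (r *\<^sub>R x) y = of_real r * ip x y"
  using ip_scale_left[of "of_real r" x y] by (simp add: scale_of_real)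

lemma ip_scaleR_right: "ip x (r *\<^sub>R y) = of_real r * ip x y"
  using ip_scale_right[of x "of_real r" y] by (simp add: scale_of_real)

lemma ip_sum_left: "ip (\<Sum>i\<in>F. f i) y = (\<Sum>i\<in>F. ip (f i) y)"
  by (induction F rule: infinite_finite_induct) (simp_all add: ip_add_left)

lemma norm_ip_commute: "norm (ip x y) = norm (ip y x)"
  by (subst ip_commute) simp

lemma norm_ip_self: "norm (ip x x) = (norm x)\<^sup>2"
  by (simp add: ip_self norm_power)

lemma ip_self_eq_0_iff [simp]: "ip x x = 0 \<longleftrightarrow> x = 0"
  by (simp add: ip_self)

lemma ip_eq_0_commute: "ip x y = 0 \<longleftrightarrow> ip y x = 0"
  using norm_ip_commute[of x y] by (metis norm_eq_zero)

lemma ip_ext: "(\<And>z. ip z x = ip z y) \<Longrightarrow> x = y"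
  using ip_self_eq_0_iff[of "x - y"] by (simp add: ip_diff_right)

lemma norm_scale: "norm (scale a x) = norm a * norm x"
proof -
  have "of_real ((norm (scale a x))\<^sup>2) = (a * conjg a) * ip x x"
    by (simp only: ip_self[symmetric] ip_scale_left ip_scale_right mult_ac)
  also have "\<dots> = of_real ((norm a * norm x)\<^sup>2)"
    by (simp only: ip_self mult_conjg_of_real of_real_mult[symmetric] power_mult_distrib)
  finally have "(norm (scale a x))\<^sup>2 = (norm a * norm x)\<^sup>2"
    by (simp only: of_real_eq_iff)
  then show ?thesis by simp
qed

lemma scaleR_scale: "r *\<^sub>R scale a x = scale (of_real r * a) x"
  using scale_of_real[of r "scale a x"] by simp

text \<open>The vector on the left is \<open>(norm y)\<^sup>2\<close> times the component of
  \<open>x\<close> orthogonal to \<open>y\<close>, with the denominator cleared. Nonnegativity of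
  the right-hand side yields Cauchy-Schwarz; the exact value is what the variational argument for
  nearest points uses.\<close>

lemma norm_orthogonal_residual:
  "(norm ((norm y)\<^sup>2 *\<^sub>R x - scale (ip x y) y))\<^sup>2 =
    (norm y)\<^sup>2 * ((norm y)\<^sup>2 * (norm x)\<^sup>2 - (norm (ip x y))\<^sup>2)"
proof -
  let ?n = "of_real ((norm y)\<^sup>2) :: 'k" and ?m = "of_real ((norm x)\<^sup>2) :: 'k" and ?a = "ip x y"
  have "(of_real ((norm ((norm y)\<^sup>2 *\<^sub>R x - scale ?a y))\<^sup>2) :: 'k) =
      ?n * (?n * ?m) - ?n * (conjg ?a * ?a) - ?a * (?n * conjg ?a) + ?a * (conjg ?a * ?n)"
    unfolding ip_self[symmetric] ip_diff_left ip_diff_right ip_scaleR_left ip_scaleR_right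
      ip_scale_left ip_scale_right ip_commute[of y x]
    by (simp add: algebra_simps)
  also have "\<dots> = ?n * (?n * ?m - ?a * conjg ?a)"
    by (simp add: algebra_simps)
  also have "\<dots> = of_real ((norm y)\<^sup>2 * ((norm y)\<^sup>2 * (norm x)\<^sup>2 - (norm ?a)\<^sup>2))"
    by (simp only: mult_conjg_of_real of_real_mult of_real_diff)
  finally show ?thesis by (simp only: of_real_eq_iff)
qed

lemma Cauchy_Schwarz: "norm (ip x y) \<le> norm x * norm y"
proof (cases "y = 0")
  case False
  have "0 \<le> (norm y)\<^sup>2 * ((norm y)\<^sup>2 * (norm x)\<^sup>2 - (norm (ip x y))\<^sup>2)"
    unfolding norm_orthogonal_residual[symmetric] by simp
  then have "(norm (ip x y))\<^sup>2 \<le> (norm x * norm y)\<^sup>2"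
    using False by (simp add: zero_le_mult_iff power_mult_distrib mult.commute)
  then show ?thesis
    by (rule power2_le_imp_le) simp
qed simp

lemma bounded_linear_ip_left: "bounded_linear (\<lambda>x. ip x y)"
  by (rule bounded_linear_intro[where K="norm y"])
    (simp_all add: ip_add_left ip_scaleR_left Cauchy_Schwarz scaleR_conv_of_real)

lemma bounded_linear_ip_right: "bounded_linear (\<lambda>y. ip x y)"
  by (rule bounded_linear_intro[where K="norm x"])
    (simp_all add: ip_add_right ip_scaleR_right Cauchy_Schwarz scaleR_conv_of_real
      mult.commute[of "norm _" "norm x"])

lemma parallelogram:
  fixes x y :: 'a
  shows "(norm (x + y))\<^sup>2 + (norm (x - y))\<^sup>2 = 2 * (norm x)\<^sup>2 + 2 * (norm y)\<^sup>2"
proof -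
  have "(of_real ((norm (x + y))\<^sup>2 + (norm (x - y))\<^sup>2) :: 'k) =
      of_real (2 * (norm x)\<^sup>2 + 2 * (norm y)\<^sup>2)"
    unfolding of_real_add of_real_mult ip_self[symmetric]
    by (simp add: ip_add_left ip_add_right ip_diff_left ip_diff_right)
  then show ?thesis by (simp only: of_real_eq_iff)
qed

section \<open>Closed subspaces and orthogonal projections\<close>

lemma closed_subspaceD: "closed_subspace W \<Longrightarrow> subspace W"
  by (simp add: closed_subspace_def)

lemma subspace_scaleR: "subspace W \<Longrightarrow> x \<in> W \<Longrightarrow> r *\<^sub>R x \<in> W"
  by (metis scale_of_real subspace_scale)

text \<open>A minimising sequence is Cauchy by the parallelogram law: the midpoint of two of its
  terms lies in \<open>W\<close>, so its squared distance to \<open>x\<close> is at least the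
  infimum \<open>\<delta>\<close>, which leaves little room for the terms to differ. The limit stays
  in \<open>W\<close> by closedness.\<close>

lemma ex_nearest_point:
  assumes W: "closed_subspace W"
  shows "\<exists>p\<in>W. \<forall>w\<in>W. norm (x - p) \<le> norm (x - w)"
proof -
  have sub: "subspace W" and cl: "closed W"
    using W by (auto simp: closed_subspace_def)
  define \<delta> where "\<delta> = (INF w\<in>W. (norm (x - w))\<^sup>2)"
  have bdd: "bdd_below ((\<lambda>w. (norm (x - w))\<^sup>2) ` W)"
    by (rule bdd_belowI2[of _ 0]) simp
  have ne: "W \<noteq> {}" using subspace_0[OF sub] by auto
  have lower: "\<delta> \<le> (norm (x - w))\<^sup>2" if "w \<in> W" for w
    unfolding \<delta>_def using bdd that by (rule cINF_lower)
  have "\<exists>w\<in>W. (norm (x - w))\<^sup>2 < \<delta> + inverse (real (Suc n))" for n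
    using cINF_less_iff[OF ne bdd] unfolding \<delta>_def[symmetric] by (metis inverse_positive_iff_positive
        less_add_same_cancel1 of_nat_0_less_iff zero_less_Suc)
  then obtain u where uW: "\<And>n. u n \<in> W"
    and u: "\<And>n. (norm (x - u n))\<^sup>2 < \<delta> + inverse (real (Suc n))"
    by metis
  have gap: "(norm (u m - u n))\<^sup>2 \<le> 2 * inverse (real (Suc m)) + 2 * inverse (real (Suc n))" for m n
  proof -
    have "(1/2) *\<^sub>R (u m + u n) \<in> W"
      by (intro subspace_scaleR subspace_add sub uW)
    from lower[OF this] have "\<delta> \<le> (norm ((1/2) *\<^sub>R ((x - u m) + (x - u n))))\<^sup>2"
      by (simp add: algebra_simps flip: scaleR_add_left)
    then have "4 * \<delta> \<le> (norm ((x - u m) + (x - u n)))\<^sup>2"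
      by (simp add: power_divide)
    moreover have "norm ((x - u m) - (x - u n)) = norm (u m - u n)"
      by (simp add: norm_minus_commute)
    ultimately show ?thesis
      using parallelogram[of "x - u m" "x - u n"] u[of m] u[of n] by simp
  qed
  have "Cauchy u"
  proof (rule CauchyI)
    fix e :: real assume "e > 0"
    then obtain N where N: "inverse (real (Suc N)) < e\<^sup>2 / 4"
      using reals_Archimedean[of "e\<^sup>2 / 4"] by auto
    have "norm (u m - u n) < e" if "m \<ge> N" "n \<ge> N" for m n
    proof -
      have "inverse (real (Suc m)) \<le> inverse (real (Suc N))"
        "inverse (real (Suc n)) \<le> inverse (real (Suc N))"
        using that by (simp_all add: le_imp_inverse_le)
      then have "(norm (u m - u n))\<^sup>2 < e\<^sup>2"
        using gap[of m n] N by linarith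
      then show ?thesis
        using \<open>e > 0\<close> by (simp add: power_less_imp_less_base)
    qed
    then show "\<exists>M. \<forall>m\<ge>M. \<forall>n\<ge>M. norm (u m - u n) < e" by blast
  qed
  then obtain p where p: "u \<longlonglongrightarrow> p"
    by (auto simp: convergent_eq_Cauchy[symmetric])
  have "p \<in> W"
    using closed_sequentially[OF cl _ p] uW by blast
  moreover have "norm (x - p) \<le> norm (x - w)" if "w \<in> W" for w
  proof -
    have "(\<lambda>n. (norm (x - u n))\<^sup>2) \<longlonglongrightarrow> (norm (x - p))\<^sup>2"
      by (intro tendsto_intros p)
    moreover have "(\<lambda>n. \<delta> + inverse (real (Suc n))) \<longlonglongrightarrow> \<delta> + 0"
      by (intro tendsto_intros LIMSEQ_inverse_real_of_nat)
    ultimately have "(norm (x - p))\<^sup>2 \<le> \<delta> + 0"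
      using u by (intro LIMSEQ_le) (auto intro: less_imp_le)
    then have "(norm (x - p))\<^sup>2 \<le> (norm (x - w))\<^sup>2"
      using lower[OF that] by linarith
    then show ?thesis by (rule power2_le_imp_le) simp
  qed
  ultimately show ?thesis by blast
qed

lemma ex_orthogonal_decomposition:
  assumes W: "closed_subspace W"
  shows "\<exists>p\<in>W. x - p \<in> orth_compl W"
proof -
  have sub: "subspace W" using W by (simp add: closed_subspace_def)
  obtain p where p: "p \<in> W" and min: "\<And>w. w \<in> W \<Longrightarrow> norm (x - p) \<le> norm (x - w)"
    using ex_nearest_point[OF W] by blast
  have "ip (x - p) w = 0" if w: "w \<in> W" for w
  proof (cases "w = 0")
    case False
    let ?n = "(norm w)\<^sup>2" and ?a = "ip (x - p) w"
    have n: "?n > 0" using False by simp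
    \<comment> \<open>This competitor removes from \<open>x - p\<close> its component along
      \<open>w\<close>. Since \<open>p\<close> is nearest, the removal cannot shorten the residual,
      so the component is zero.\<close>
    have "p + (1 / ?n) *\<^sub>R scale ?a w \<in> W"
      by (intro subspace_add subspace_scaleR subspace_scale sub p w)
    from min[OF this] have "?n * norm (x - p) \<le> norm (?n *\<^sub>R (x - (p + (1 / ?n) *\<^sub>R scale ?a w)))"
      using n by simp
    also have "?n *\<^sub>R (x - (p + (1 / ?n) *\<^sub>R scale ?a w)) = ?n *\<^sub>R (x - p) - scale ?a w"
      using n by (simp add: algebra_simps)
    finally have "(?n * norm (x - p))\<^sup>2 \<le> ?n * (?n * (norm (x - p))\<^sup>2 - (norm ?a)\<^sup>2)"
      unfolding norm_orthogonal_residual[symmetric] by (intro power_mono) auto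
    then have "?n * (norm ?a)\<^sup>2 \<le> 0"
      by (simp add: power2_eq_square algebra_simps)
    then show ?thesis using n by (simp add: mult_le_0_iff)
  qed simp
  then show ?thesis using p by (auto simp: orth_compl_def)
qed

lemma orth_compl_disjoint: "x \<in> W \<Longrightarrow> x \<in> orth_compl W \<Longrightarrow> x = 0"
  by (auto simp: orth_compl_def)

lemma subspace_orth_compl: "subspace (orth_compl W)"
  by (rule subspaceI) (auto simp: orth_compl_def ip_add_left ip_scale_left)

text \<open>Two candidates differ by a vector lying both in \<open>W\<close> and in its orthogonal
  complement. This settles the definite description behind \<open>proj\<close>; the basic facts
  about projections are obtained by exhibiting a candidate.\<close>

lemma proj_eqI:
  assumes W: "closed_subspace W" and p: "p \<in> W" "x - p \<in> orth_compl W"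
  shows "proj W x = p"
  unfolding proj_def
proof (rule the_equality)
  fix q assume q: "q \<in> W \<and> x - q \<in> orth_compl W"
  have "q - p \<in> W"
    using W p q by (auto simp: closed_subspace_def subspace_diff)
  moreover have "(x - p) - (x - q) \<in> orth_compl W"
    using p q by (metis subspace_diff[OF subspace_orth_compl])
  ultimately show "q = p"
    using orth_compl_disjoint[of "q - p"] by simp
qed (use p in simp)

lemma proj_in: "closed_subspace W \<Longrightarrow> proj W x \<in> W"
  and proj_residual: "closed_subspace W \<Longrightarrow> x - proj W x \<in> orth_compl W"
  using ex_orthogonal_decomposition[of W x] proj_eqI[of W _ x] by auto

lemma proj_id: "closed_subspace W \<Longrightarrow> x \<in> W \<Longrightarrow> proj W x = x"
  by (rule proj_eqI) (auto simp: orth_compl_def)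

lemma proj_orth: "closed_subspace W \<Longrightarrow> x \<in> orth_compl W \<Longrightarrow> proj W x = 0"
  by (rule proj_eqI) (auto simp: closed_subspace_def subspace_0)

lemma ip_proj_left:
  assumes W: "closed_subspace W" and w: "w \<in> W"
  shows "ip (proj W x) w = ip x w"
  using proj_residual[OF W, of x] w by (simp add: orth_compl_def ip_diff_left)

lemma ip_proj_right:
  assumes W: "closed_subspace W" and w: "w \<in> W"
  shows "ip w (proj W x) = ip w x"
  by (simp only: ip_commute[of w] ip_proj_left[OF assms])

lemma ip_proj_self_adjoint: "closed_subspace W \<Longrightarrow> ip (proj W x) y = ip x (proj W y)"
  using ip_proj_left[of W "proj W y" x] ip_proj_right[of W "proj W x" y] by (simp add: proj_in)

lemma norm_proj_le: "closed_subspace W \<Longrightarrow> norm (proj W x) \<le> norm x"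
proof -
  assume W: "closed_subspace W"
  have "(norm (proj W x))\<^sup>2 = norm (ip x (proj W x))"
    using ip_proj_left[OF W proj_in[OF W]] by (simp flip: norm_ip_self)
  also have "\<dots> \<le> norm x * norm (proj W x)" by (rule Cauchy_Schwarz)
  finally show ?thesis
    by (cases "proj W x = 0") (simp_all add: power2_eq_square mult_le_cancel_right)
qed

lemma linear_iff': "Vector_Spaces.linear scale scale f \<longleftrightarrow>
    (\<forall>x y. f (x + y) = f x + f y) \<and> (\<forall>a x. f (scale a x) = scale a (f x))"
  using vector_space_axioms by (simp add: Vector_Spaces.linear_iff)

lemma proj_add: "closed_subspace W \<Longrightarrow> proj W (x + y) = proj W x + proj W y"
  by (rule proj_eqI)
    (simp_all add: proj_in subspace_add closed_subspaceD subspace_orth_compl add_diff_add proj_residual)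

lemma proj_scale: "closed_subspace W \<Longrightarrow> proj W (scale a x) = scale a (proj W x)"
  by (rule proj_eqI)
    (simp_all add: proj_in subspace_scale closed_subspaceD subspace_orth_compl proj_residual
      flip: scale_right_diff_distrib)

section \<open>Bounded operators, Riesz representation and adjoints\<close>

lemma bounded_op_add: "bounded_op Q \<Longrightarrow> Q (x + y) = Q x + Q y"
  and bounded_op_scale: "bounded_op Q \<Longrightarrow> Q (scale a x) = scale a (Q x)"
  by (simp_all add: bounded_op_def linear_iff')

lemma bounded_op_scaleR: "bounded_op Q \<Longrightarrow> Q (r *\<^sub>R x) = r *\<^sub>R Q x"
  using bounded_op_scale[of Q "of_real r" x] by (simp add: scale_of_real)

lemma bounded_opI:
  assumes "\<And>x y. Q (x + y) = Q x + Q y" "\<And>a x. Q (scale a x) = scale a (Q x)"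
    and "\<And>x. norm (Q x) \<le> norm x * K"
  shows "bounded_op Q"
  using assms by (auto simp: bounded_op_def linear_iff')

lemma bounded_op_bounded_linear: "bounded_op Q \<Longrightarrow> bounded_linear Q"
  using bounded_linear_intro[of Q] bounded_op_add[of Q] bounded_op_scaleR[of Q]
  by (auto simp: bounded_op_def)

text \<open>The kernel condition of FF-duals enters through this factorisation: \<open>Q\<close>
  kills the residual \<open>x - proj W x\<close>.\<close>

lemma bounded_op_proj_absorb:
  assumes Q: "bounded_op Q" and W: "closed_subspace W" and ker: "orth_compl W \<subseteq> {x. Q x = 0}"
  shows "Q (proj W x) = Q x"
proof -
  have "Q (x - proj W x) = 0" using proj_residual[OF W] ker by auto
  then show ?thesis
    using linear_diff[OF bounded_linear.linear[OF bounded_op_bounded_linear[OF Q]]] by simp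
qed

text \<open>The residual \<open>x - proj W x\<close> is orthogonal both to \<open>x\<close> and to
  \<open>proj W x\<close>, hence to itself. This turns range conditions into orthogonality
  conditions, for adjoints as well as for the surjectivity of the frame operator.\<close>

lemma orth_compl_orth_compl:
  assumes W: "closed_subspace W" and x: "\<And>w. w \<in> orth_compl W \<Longrightarrow> ip w x = 0"
  shows "x \<in> W"
proof -
  let ?e = "x - proj W x"
  have e: "?e \<in> orth_compl W" by (rule proj_residual[OF W])
  then have "ip ?e ?e = 0"
    using x[OF e] proj_in[OF W] by (auto simp: orth_compl_def ip_diff_right)
  then show ?thesis using proj_in[OF W, of x] by simp
qed

text \<open>If \<open>f\<close> is nonzero, its kernel is a closed subspace whose complement
  contains some \<open>e\<close> with \<open>f e\<close> nonzero. Every \<open>x\<close> differs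
  from a multiple of \<open>e\<close> by an element of the kernel, so pairing with \<open>e\<close>
  recovers \<open>f x\<close> up to a constant.\<close>

lemma Riesz_representation:
  assumes add: "\<And>x y. f (x + y) = f x + f y" and sc: "\<And>a x. f (scale a x) = a * f x"
    and bd: "\<And>x. norm (f x) \<le> norm x * K"
  shows "\<exists>z. \<forall>x. f x = ip x z"
proof (cases "\<forall>x. f x = 0")
  case True
  then show ?thesis by (intro exI[of _ 0]) simp
next
  case False
  then obtain u where u: "f u \<noteq> 0" by blast
  have bl: "bounded_linear f"
    using bd by (intro bounded_linear_intro[where K=K] add)
      (metis sc scale_of_real scaleR_conv_of_real)
  interpret f: bounded_linear f by (rule bl)
  let ?N = "{x. f x = 0}"
  have N: "closed_subspace ?N"
    unfolding closed_subspace_def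
    by (auto intro!: subspaceI closed_Collect_eq simp: f.zero add sc f.continuous_on)
  define e where "e = u - proj ?N u"
  have "f (proj ?N u) = 0" using proj_in[OF N, of u] by simp
  then have fe: "f e \<noteq> 0" using u by (simp add: e_def f.diff)
  then have e0: "e \<noteq> 0" using f.zero by auto
  have e_orth: "e \<in> orth_compl ?N" unfolding e_def by (rule proj_residual[OF N])
  \<comment> \<open>The conjugate compensates for \<open>ip\<close> being conjugate-linear in its
    second argument.\<close>
  let ?z = "scale (conjg (f e / of_real ((norm e)\<^sup>2))) e"
  have "f x = ip x ?z" for x
  proof -
    have "f (x - scale (f x / f e) e) = 0"
      using fe by (simp add: f.diff sc)
    then have "ip (x - scale (f x / f e) e) e = 0"
      using e_orth by (subst ip_eq_0_commute) (auto simp: orth_compl_def)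
    then have "ip x e = f x / f e * of_real ((norm e)\<^sup>2)"
      by (simp add: ip_diff_left ip_scale_left ip_self)
    then show ?thesis
      using fe e0 by (simp add: ip_scale_right)
  qed
  then show ?thesis by blast
qed

text \<open>Riesz representation is applied to \<open>\<lambda>x. ip (Q x) y\<close> for each
  \<open>y\<close>. Bounding each operator by the norm of the other gives equality of the norms,
  which carries the normalisation \<open>onorm (Q i) = 1\<close> over to the adjoints.\<close>

lemma ex_adjoint:
  assumes Q: "bounded_op Q"
  shows "\<exists>R. bounded_op R \<and> (\<forall>x y. ip (Q x) y = ip x (R y)) \<and> onorm R = onorm Q"
proof -
  note bl = bounded_op_bounded_linear[OF Q]
  have "\<exists>z. \<forall>x. ip (Q x) y = ip x z" for y
  proof (rule Riesz_representation)
    show "norm (ip (Q x) y) \<le> norm x * (onorm Q * norm y)" for x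
      using Cauchy_Schwarz[of "Q x" y] mult_right_mono[OF onorm[OF bl, of x] norm_ge_zero[of y]]
      by (simp add: mult_ac)
  qed (use Q in \<open>simp_all add: bounded_op_add bounded_op_scale ip_add_left ip_scale_left\<close>)
  then obtain R where R: "\<And>x y. ip (Q x) y = ip x (R y)" by metis
  have norm_R: "norm (R y) \<le> onorm Q * norm y" for y
  proof -
    have "(norm (R y))\<^sup>2 = norm (ip (Q (R y)) y)" by (simp add: R norm_ip_self)
    also have "\<dots> \<le> (onorm Q * norm (R y)) * norm y"
      by (rule order_trans[OF Cauchy_Schwarz]) (intro mult_right_mono onorm bl norm_ge_zero)
    finally have "norm (R y) * norm (R y) \<le> (onorm Q * norm y) * norm (R y)"
      by (simp add: power2_eq_square mult_ac)
    then show ?thesis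
      using onorm_pos_le[OF bl] by (cases "R y = 0") (simp_all add: mult_le_cancel_right)
  qed
  have R_op: "bounded_op R"
  proof (rule bounded_opI[where K="onorm Q"])
    show "R (x + y) = R x + R y" for x y
      by (rule ip_ext) (simp add: ip_add_right flip: R)
    show "R (scale a x) = scale a (R x)" for a x
      by (rule ip_ext) (simp add: ip_scale_right flip: R)
  qed (use norm_R in \<open>simp add: mult.commute\<close>)
  note bl_R = bounded_op_bounded_linear[OF R_op]
  have "norm (Q x) \<le> onorm R * norm x" for x
  proof -
    have "(norm (Q x))\<^sup>2 = norm (ip x (R (Q x)))" by (simp add: norm_ip_self flip: R)
    also have "\<dots> \<le> norm x * (onorm R * norm (Q x))"
      by (rule order_trans[OF Cauchy_Schwarz]) (intro mult_left_mono onorm bl_R norm_ge_zero)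
    finally have "norm (Q x) * norm (Q x) \<le> (onorm R * norm x) * norm (Q x)"
      by (simp add: power2_eq_square mult_ac)
    then show ?thesis
      using onorm_pos_le[OF bl_R] by (cases "Q x = 0") (simp_all add: mult_le_cancel_right)
  qed
  then have "onorm Q \<le> onorm R"
    by (intro onorm_bound onorm_pos_le bl_R)
  moreover have "onorm R \<le> onorm Q"
    by (intro onorm_bound onorm_pos_le bl norm_R)
  ultimately show ?thesis using R R_op by auto
qed

section \<open>Bessel fusion sequences and FF-duals\<close>

lemma fusion_frame_imp_bessel: "fusion_frame I W c \<Longrightarrow> bessel_fusion_sequence I W c"
  unfolding fusion_frame_def bessel_fusion_sequence_def by blast

lemma fusion_sequence_closed: "fusion_sequence I W c \<Longrightarrow> i \<in> I \<Longrightarrow> closed_subspace (W i)"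
  and fusion_sequence_nonneg: "fusion_sequence I W c \<Longrightarrow> i \<in> I \<Longrightarrow> c i \<ge> 0"
  and fusion_sequence_trivial: "fusion_sequence I W c \<Longrightarrow> i \<in> I \<Longrightarrow> W i = {0} \<longleftrightarrow> c i = 0"
  by (auto simp: fusion_sequence_def)

section \<open>Bessel bounds and synthesis\<close>

lemma bessel_fusion_sequenceE:
  assumes "bessel_fusion_sequence I W c"
  obtains \<beta> where "\<beta> > 0" "fusion_sequence I W c"
    "\<And>x. (\<lambda>i. (c i * norm (proj (W i) x))\<^sup>2) summable_on I"
    "\<And>x. (\<Sum>\<^sub>\<infinity>i\<in>I. (c i * norm (proj (W i) x))\<^sup>2) \<le> \<beta> * (norm x)\<^sup>2"
  using assms unfolding bessel_fusion_sequence_def power_mult_distrib by blast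

text \<open>Duality between analysis and synthesis: the finite sum \<open>y\<close> is paired with
  itself, the self-adjoint projections move onto \<open>y\<close>, and the Bessel bound at
  \<open>y\<close> absorbs one factor \<open>(norm y)\<^sup>2\<close> after Cauchy-Schwarz.\<close>

lemma synthesis_partial_bound:
  assumes W: "fusion_sequence I W c"
    and sm: "\<And>x. (\<lambda>i. (c i * norm (proj (W i) x))\<^sup>2) summable_on I"
    and bd: "\<And>x. (\<Sum>\<^sub>\<infinity>i\<in>I. (c i * norm (proj (W i) x))\<^sup>2) \<le> \<beta> * (norm x)\<^sup>2"
    and F: "finite F" "F \<subseteq> I"
  shows "(norm (\<Sum>i\<in>F. c i *\<^sub>R proj (W i) (a i)))\<^sup>2 \<le> \<beta> * (\<Sum>i\<in>F. (norm (a i))\<^sup>2)"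
proof -
  define y where "y = (\<Sum>i\<in>F. c i *\<^sub>R proj (W i) (a i))"
  have term_le: "norm (ip (c i *\<^sub>R proj (W i) (a i)) y) \<le> norm (a i) * (c i * norm (proj (W i) y))"
    if "i \<in> F" for i
  proof -
    have i: "i \<in> I" using that F by auto
    have "norm (ip (c i *\<^sub>R proj (W i) (a i)) y) = c i * norm (ip (a i) (proj (W i) y))"
      using fusion_sequence_nonneg[OF W i]
      by (simp add: ip_scaleR_left ip_proj_self_adjoint[OF fusion_sequence_closed[OF W i]] norm_mult)
    also have "\<dots> \<le> c i * (norm (a i) * norm (proj (W i) y))"
      by (intro mult_left_mono Cauchy_Schwarz fusion_sequence_nonneg[OF W i])
    finally show ?thesis by (simp add: mult_ac)
  qed
  have "(norm y)\<^sup>2 = norm (\<Sum>i\<in>F. ip (c i *\<^sub>R proj (W i) (a i)) y)"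
    by (simp add: y_def flip: norm_ip_self ip_sum_left)
  also have "\<dots> \<le> (\<Sum>i\<in>F. norm (a i) * (c i * norm (proj (W i) y)))"
    by (intro sum_norm_le term_le)
  finally have "((norm y)\<^sup>2)\<^sup>2 \<le> (\<Sum>i\<in>F. norm (a i) * (c i * norm (proj (W i) y)))\<^sup>2"
    by (intro power_mono) auto
  also have "\<dots> \<le> (\<Sum>i\<in>F. (norm (a i))\<^sup>2) * (\<Sum>i\<in>F. (c i * norm (proj (W i) y))\<^sup>2)"
    by (rule Cauchy_Schwarz_ineq_sum)
  also have "\<dots> \<le> (\<Sum>i\<in>F. (norm (a i))\<^sup>2) * (\<beta> * (norm y)\<^sup>2)"
    using F by (intro mult_left_mono order_trans[OF finite_sum_le_infsum[OF sm] bd] sum_nonneg) auto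
  finally have le: "(norm y)\<^sup>2 * (norm y)\<^sup>2 \<le> (\<beta> * (\<Sum>i\<in>F. (norm (a i))\<^sup>2)) * (norm y)\<^sup>2"
    by (simp add: power2_eq_square mult_ac)
  show ?thesis
  proof (cases "y = 0")
    case True
    \<comment> \<open>The sign of \<open>\<beta>\<close> is not among the assumptions; the Bessel
      bound at a nonzero \<open>a i\<close> supplies it.\<close>
    have "0 \<le> \<beta> * (\<Sum>i\<in>F. (norm (a i))\<^sup>2)"
    proof (cases "\<forall>i\<in>F. a i = 0")
      case False
      then obtain i where "a i \<noteq> 0" by blast
      moreover have "0 \<le> \<beta> * (norm (a i))\<^sup>2"
        by (rule order_trans[OF infsum_nonneg bd]) simp
      ultimately have "0 \<le> \<beta>" by (simp add: zero_le_mult_iff)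
      then show ?thesis by (intro mult_nonneg_nonneg sum_nonneg) auto
    qed simp
    then show ?thesis using True by (simp add: y_def)
  next
    case False
    then show ?thesis using mult_right_le_imp_le[OF le] by (simp add: y_def)
  qed
qed

lemma synthesis_summable:
  assumes W: "bessel_fusion_sequence I W c"
    and a: "(\<lambda>i. (norm (a i))\<^sup>2) summable_on I"
  shows "(\<lambda>i. c i *\<^sub>R proj (W i) (a i)) summable_on I"
proof -
  obtain \<beta> where \<beta>: "\<beta> > 0" and W': "fusion_sequence I W c"
    "\<And>x. (\<lambda>i. (c i * norm (proj (W i) x))\<^sup>2) summable_on I"
    "\<And>x. (\<Sum>\<^sub>\<infinity>i\<in>I. (c i * norm (proj (W i) x))\<^sup>2) \<le> \<beta> * (norm x)\<^sup>2"
    using bessel_fusion_sequenceE[OF W] by metis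
  show ?thesis
    by (rule summable_on_if_square_bound[OF a \<beta>]) (rule synthesis_partial_bound[OF W'])
qed

text \<open>Termwise domination by the Bessel sum evaluated at \<open>h x\<close>. The vectors of a
  dual frame are treated with \<open>h\<close> the identity, the canonical dual with
  \<open>h\<close> the inverse frame operator.\<close>

lemma bessel_by_comparison:
  assumes W: "bessel_fusion_sequence I W c" and K: "K > 0"
    and g: "\<And>x i. i \<in> I \<Longrightarrow> 0 \<le> g x i \<and> g x i \<le> K * (c i * norm (proj (W i) (h x)))\<^sup>2"
    and h: "\<And>x. norm (h x) \<le> L * norm x" and L: "L > 0"
  shows "\<exists>\<beta>>0. \<forall>x. g x summable_on I \<and> infsum (g x) I \<le> \<beta> * (norm x)\<^sup>2"
proof -
  obtain \<beta> where \<beta>: "\<beta> > 0"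
    and sm: "\<And>x. (\<lambda>i. (c i * norm (proj (W i) x))\<^sup>2) summable_on I"
    and bd: "\<And>x. (\<Sum>\<^sub>\<infinity>i\<in>I. (c i * norm (proj (W i) x))\<^sup>2) \<le> \<beta> * (norm x)\<^sup>2"
    using bessel_fusion_sequenceE[OF W] by metis
  have "g x summable_on I \<and> infsum (g x) I \<le> (K * \<beta> * L\<^sup>2) * (norm x)\<^sup>2" for x
  proof
    have sm': "(\<lambda>i. K * (c i * norm (proj (W i) (h x)))\<^sup>2) summable_on I"
      by (intro summable_on_cmult_right sm)
    show gs: "g x summable_on I"
      by (rule summable_on_comparison_test[OF sm']) (use g in auto)
    have "infsum (g x) I \<le> (\<Sum>\<^sub>\<infinity>i\<in>I. K * (c i * norm (proj (W i) (h x)))\<^sup>2)"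
      by (rule infsum_mono[OF gs sm']) (use g in auto)
    also have "\<dots> = K * (\<Sum>\<^sub>\<infinity>i\<in>I. (c i * norm (proj (W i) (h x)))\<^sup>2)"
      by (rule infsum_cmult_right) (rule sm)
    also have "\<dots> \<le> K * (\<beta> * (L * norm x)\<^sup>2)"
      using K \<beta> by (intro mult_left_mono order_trans[OF bd] power_mono h) auto
    finally show "infsum (g x) I \<le> (K * \<beta> * L\<^sup>2) * (norm x)\<^sup>2"
      by (simp add: power_mult_distrib mult_ac)
  qed
  moreover have "K * \<beta> * L\<^sup>2 > 0" using K \<beta> L by simp
  ultimately show ?thesis by blast
qed

text \<open>At null indices the norm of \<open>Q i\<close> is unconstrained, but the weight
  \<open>c i * d i\<close> vanishes. Elsewhere \<open>Q i\<close> has norm one and factors through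
  the projection onto \<open>W i\<close>.\<close>

lemma ff_dual_ops_term_bound:
  assumes W: "fusion_sequence I W c" and V: "fusion_sequence I V d"
    and Q: "ff_dual_ops I V d W c Q" and i: "i \<in> I"
  shows "norm ((c i * d i) *\<^sub>R Q i x) \<le> c i * d i * norm (proj (W i) x)"
proof (cases "i \<in> null_indices I V W")
  case True
  then have "c i * d i = 0"
    using fusion_sequence_trivial[OF W i] fusion_sequence_trivial[OF V i]
    by (auto simp: null_indices_def)
  then show ?thesis by auto
next
  case False
  have Qi: "bounded_op (Q i)" "orth_compl (W i) \<subseteq> {x. Q i x = 0}" "onorm (Q i) = 1"
    using Q i False by (auto simp: ff_dual_ops_def)
  have "norm (Q i x) \<le> norm (proj (W i) x)"
    using onorm[OF bounded_op_bounded_linear[OF Qi(1)], of "proj (W i) x"]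
      bounded_op_proj_absorb[OF Qi(1) fusion_sequence_closed[OF W i] Qi(2)] Qi(3) by simp
  then show ?thesis
    using fusion_sequence_nonneg[OF W i] fusion_sequence_nonneg[OF V i]
    by (simp add: mult_left_mono)
qed

text \<open>Termwise this is the series in the definition of FF-duals: the projection onto
  \<open>V i\<close> fixes the range of \<open>Q i\<close>, and the projection onto
  \<open>W i\<close> is absorbed by \<open>Q i\<close>.\<close>

lemma ff_dual_reconstruction:
  assumes D: "ff_dual I V d W c" and Q: "ff_dual_ops I V d W c Q"
  shows "((\<lambda>i. d i *\<^sub>R proj (V i) (Q i (c i *\<^sub>R proj (W i) x))) has_sum x) I"
proof -
  have W: "fusion_sequence I W c" and V: "fusion_sequence I V d"
    using D by (auto simp: ff_dual_def fusion_frame_def bessel_fusion_sequence_def)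
  have "d i *\<^sub>R proj (V i) (Q i (c i *\<^sub>R proj (W i) x)) = (c i * d i) *\<^sub>R Q i x" if i: "i \<in> I" for i
  proof -
    have Qi: "bounded_op (Q i)" "orth_compl (W i) \<subseteq> {x. Q i x = 0}" "range (Q i) \<subseteq> V i"
      using Q i by (auto simp: ff_dual_ops_def)
    have "proj (V i) (Q i (c i *\<^sub>R proj (W i) x)) = Q i (c i *\<^sub>R proj (W i) x)"
      using Qi(3) by (intro proj_id fusion_sequence_closed[OF V i]) auto
    then show ?thesis
      by (simp add: bounded_op_scaleR[OF Qi(1)] mult.commute
          bounded_op_proj_absorb[OF Qi(1) fusion_sequence_closed[OF W i] Qi(2)])
  qed
  then show ?thesis
    using Q by (simp add: ff_dual_ops_def cong: has_sum_cong)
qed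

lemma ff_dual_fusion_frame:
  assumes D: "ff_dual I V d W c"
  shows "fusion_frame I V d"
proof -
  obtain Q where Q: "ff_dual_ops I V d W c Q" using D by (auto simp: ff_dual_def)
  have WB: "bessel_fusion_sequence I W c" and VB: "bessel_fusion_sequence I V d"
    using D fusion_frame_imp_bessel by (auto simp: ff_dual_def)
  obtain \<beta> where \<beta>: "\<beta> > 0" and W: "fusion_sequence I W c"
    and smW: "\<And>x. (\<lambda>i. (c i * norm (proj (W i) x))\<^sup>2) summable_on I"
    and bdW: "\<And>x. (\<Sum>\<^sub>\<infinity>i\<in>I. (c i * norm (proj (W i) x))\<^sup>2) \<le> \<beta> * (norm x)\<^sup>2"
    using bessel_fusion_sequenceE[OF WB] by metis
  obtain \<gamma> where \<gamma>: "\<gamma> > 0" and V: "fusion_sequence I V d"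
    and smV: "\<And>x. (\<lambda>i. (d i * norm (proj (V i) x))\<^sup>2) summable_on I"
    and bdV: "\<And>x. (\<Sum>\<^sub>\<infinity>i\<in>I. (d i * norm (proj (V i) x))\<^sup>2) \<le> \<gamma> * (norm x)\<^sup>2"
    using bessel_fusion_sequenceE[OF VB] by metis
  \<comment> \<open>The lower frame bound of the dual is the reciprocal of a Bessel bound of
    \<open>W\<close>.\<close>
  have "1 / \<beta> * (norm x)\<^sup>2 \<le> (\<Sum>\<^sub>\<infinity>i\<in>I. (d i * norm (proj (V i) x))\<^sup>2)" (is "_ \<le> ?s") for x
  proof (cases "x = 0")
    case True
    then show ?thesis by (simp add: infsum_nonneg)
  next
    case False
    have "((\<lambda>i. (c i * d i) *\<^sub>R Q i x) has_sum x) I"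
      using Q by (simp add: ff_dual_ops_def)
    from has_sum_bounded_linear[OF bounded_linear_ip_left this]
    have sum: "((\<lambda>i. ip ((c i * d i) *\<^sub>R Q i x) x) has_sum ip x x) I" .
    have "norm (ip ((c i * d i) *\<^sub>R Q i x) x) \<le> (c i * norm (proj (W i) x)) * (d i * norm (proj (V i) x))"
      if i: "i \<in> I" for i
    proof -
      have clV: "closed_subspace (V i)" by (rule fusion_sequence_closed[OF V i])
      have "(c i * d i) *\<^sub>R Q i x \<in> V i"
        using Q i by (intro subspace_scaleR closed_subspaceD[OF clV]) (auto simp: ff_dual_ops_def)
      then have "norm (ip ((c i * d i) *\<^sub>R Q i x) x) = norm (ip ((c i * d i) *\<^sub>R Q i x) (proj (V i) x))"
        using ip_proj_right[OF clV] by metis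
      also have "\<dots> \<le> (c i * d i * norm (proj (W i) x)) * norm (proj (V i) x)"
        by (rule order_trans[OF Cauchy_Schwarz])
          (intro mult_right_mono ff_dual_ops_term_bound[OF W V Q i] norm_ge_zero)
      finally show ?thesis by (simp add: mult_ac)
    qed
    from has_sum_Cauchy_Schwarz[OF sum this smW smV]
    have "((norm x)\<^sup>2)\<^sup>2 \<le> (\<Sum>\<^sub>\<infinity>i\<in>I. (c i * norm (proj (W i) x))\<^sup>2) * ?s"
      by (simp add: norm_ip_self)
    also have "\<dots> \<le> (\<beta> * (norm x)\<^sup>2) * ?s"
      by (intro mult_right_mono bdW infsum_nonneg) simp
    finally have "(norm x)\<^sup>2 * (norm x)\<^sup>2 \<le> (\<beta> * ?s) * (norm x)\<^sup>2"
      by (simp add: power2_eq_square mult_ac)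
    then have "(norm x)\<^sup>2 \<le> \<beta> * ?s"
      by (rule mult_right_le_imp_le) (use False in simp)
    then show ?thesis using \<beta> by (simp add: field_simps)
  qed
  then show ?thesis
    unfolding fusion_frame_def power_mult_distrib[symmetric]
    using V smV bdV \<gamma> \<beta> by (intro conjI exI[of _ "1 / \<beta>"] exI[of _ \<gamma>]) auto
qed

lemma null_indices_commute: "null_indices I V W = null_indices I W V"
  by (auto simp: null_indices_def)

theorem ff_dual_symmetric:
  assumes D: "ff_dual I V d W c"
  shows "ff_dual I W c V d"
proof -
  obtain Q where Q: "ff_dual_ops I V d W c Q" using D by (auto simp: ff_dual_def)
  have WB: "bessel_fusion_sequence I W c" and VB: "bessel_fusion_sequence I V d"
    using D fusion_frame_imp_bessel by (auto simp: ff_dual_def)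
  have W: "fusion_sequence I W c" and V: "fusion_sequence I V d"
    using WB VB by (auto simp: bessel_fusion_sequence_def)
  have smV: "\<And>x. (\<lambda>i. (d i * norm (proj (V i) x))\<^sup>2) summable_on I"
    using bessel_fusion_sequenceE[OF VB] by metis
  have "\<exists>R. bounded_op R \<and> (\<forall>x y. ip (Q i x) y = ip x (R y)) \<and> onorm R = onorm (Q i)" if "i \<in> I" for i
    using Q that by (intro ex_adjoint) (auto simp: ff_dual_ops_def)
  then obtain R where R_op: "\<And>i. i \<in> I \<Longrightarrow> bounded_op (R i)"
    and R: "\<And>i x y. i \<in> I \<Longrightarrow> ip (Q i x) y = ip x (R i y)"
    and R_norm: "\<And>i. i \<in> I \<Longrightarrow> onorm (R i) = onorm (Q i)"
    by metis
  \<comment> \<open>Passing to adjoints exchanges the two conditions: the range of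
    \<open>Q i\<close> governs the kernel of \<open>R i\<close>, and the kernel of
    \<open>Q i\<close> governs the range of \<open>R i\<close>.\<close>
  have R_ker: "R i y = 0" if i: "i \<in> I" and y: "y \<in> orth_compl (V i)" for i y
  proof (rule ip_ext)
    fix z
    have "Q i z \<in> V i" using Q i by (auto simp: ff_dual_ops_def)
    then have "ip y (Q i z) = 0" using y by (simp add: orth_compl_def)
    then show "ip z (R i y) = ip z 0"
      by (simp add: ip_eq_0_commute[of y] R[OF i])
  qed
  have R_ran: "R i y \<in> W i" if i: "i \<in> I" for i y
  proof (rule orth_compl_orth_compl[OF fusion_sequence_closed[OF W i]])
    fix w assume "w \<in> orth_compl (W i)"
    then have "Q i w = 0" using Q i by (auto simp: ff_dual_ops_def)
    then show "ip w (R i y) = 0" by (simp flip: R[OF i])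
  qed
  have "((\<lambda>i. (d i * c i) *\<^sub>R R i x) has_sum x) I" for x
  proof -
    \<comment> \<open>At null indices \<open>norm (R i x)\<close> is not controlled, so
      \<open>a\<close> is set to zero there to make it square-summable. The synthesised series is
      unaffected, since \<open>d i * c i = 0\<close> at these indices.\<close>
    define a where "a i = (if i \<in> null_indices I V W then 0 else d i *\<^sub>R R i x)" for i
    have "(norm (a i))\<^sup>2 \<le> (d i * norm (proj (V i) x))\<^sup>2" if i: "i \<in> I" for i
    proof (cases "i \<in> null_indices I V W")
      case False
      then have "onorm (R i) = 1" using Q i R_norm by (auto simp: ff_dual_ops_def)
      moreover have "R i (proj (V i) x) = R i x"
        using R_ker[OF i] by (intro bounded_op_proj_absorb R_op fusion_sequence_closed[OF V] i) auto
      ultimately have "norm (R i x) \<le> norm (proj (V i) x)"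
        using onorm[OF bounded_op_bounded_linear[OF R_op[OF i]], of "proj (V i) x"] by simp
      then show ?thesis
        using False fusion_sequence_nonneg[OF V i]
        by (auto simp: a_def intro!: power_mono mult_left_mono)
    qed (simp add: a_def)
    then have "(\<lambda>i. (norm (a i))\<^sup>2) summable_on I"
      by (intro summable_on_comparison_test[OF smV]) auto
    from synthesis_summable[OF WB this]
    obtain L where "((\<lambda>i. c i *\<^sub>R proj (W i) (a i)) has_sum L) I"
      by (auto simp: summable_on_def)
    moreover have "c i *\<^sub>R proj (W i) (a i) = (d i * c i) *\<^sub>R R i x" if i: "i \<in> I" for i
    proof (cases "i \<in> null_indices I V W")
      case True
      then have "d i * c i = 0"
        using fusion_sequence_trivial[OF W i] fusion_sequence_trivial[OF V i]
        by (auto simp: null_indices_def)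
      then show ?thesis
        using True fusion_sequence_closed[OF W i]
        by (auto simp: a_def proj_id closed_subspace_def subspace_0)
    next
      case False
      have "d i *\<^sub>R R i x \<in> W i"
        by (intro subspace_scaleR closed_subspaceD[OF fusion_sequence_closed[OF W i]] R_ran i)
      then show ?thesis
        using False by (simp add: a_def proj_id[OF fusion_sequence_closed[OF W i]] mult.commute)
    qed
    ultimately have L: "((\<lambda>i. (d i * c i) *\<^sub>R R i x) has_sum L) I"
      by (simp cong: has_sum_cong)
    \<comment> \<open>Convergence is known by now; the value is identified weakly, by moving each
      \<open>R i\<close> back to \<open>Q i\<close> and using the reconstruction of
      \<open>z\<close>.\<close>
    have "L = x"
    proof (rule ip_ext)
      fix z
      have "((\<lambda>i. ip z ((d i * c i) *\<^sub>R R i x)) has_sum ip z L) I"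
        by (rule has_sum_bounded_linear[OF bounded_linear_ip_right L])
      moreover have "ip z ((d i * c i) *\<^sub>R R i x) = ip ((c i * d i) *\<^sub>R Q i z) x" if "i \<in> I" for i
        by (simp add: ip_scaleR_left ip_scaleR_right R[OF that] mult_ac)
      ultimately have "((\<lambda>i. ip ((c i * d i) *\<^sub>R Q i z) x) has_sum ip z L) I"
        by (simp cong: has_sum_cong)
      moreover have "((\<lambda>i. ip ((c i * d i) *\<^sub>R Q i z) x) has_sum ip z x) I"
        using Q by (intro has_sum_bounded_linear[OF bounded_linear_ip_left]) (simp add: ff_dual_ops_def)
      ultimately show "ip z L = ip z x" by (rule has_sum_unique)
    qed
    then show ?thesis using L by simp
  qed
  then have "ff_dual_ops I W c V d R"
    using R_op R_ker R_ran R_norm Q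
    by (auto simp: ff_dual_ops_def null_indices_commute[of I W V])
  then show ?thesis
    using ff_dual_fusion_frame[OF D] WB by (auto simp: ff_dual_def)
qed

section \<open>One-dimensional subspaces\<close>

lemma span_singleton_eq_0_iff: "span {v} = {0} \<longleftrightarrow> v = 0"
  using span_base[of v "{v}"] by auto

text \<open>Describes a line as the solution set of an equation between continuous functions, from
  which closedness is immediate.\<close>

lemma in_span_singleton_iff:
  assumes "v \<noteq> 0"
  shows "x \<in> span {v} \<longleftrightarrow> (norm v)\<^sup>2 *\<^sub>R x = scale (ip x v) v"
proof
  assume "x \<in> span {v}"
  then show "(norm v)\<^sup>2 *\<^sub>R x = scale (ip x v) v"
    by (auto simp: span_singleton ip_scale_left ip_self scaleR_scale mult.commute)
next
  assume eq: "(norm v)\<^sup>2 *\<^sub>R x = scale (ip x v) v"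
  have "x = (1 / (norm v)\<^sup>2) *\<^sub>R scale (ip x v) v"
    using assms by (simp flip: eq)
  then show "x \<in> span {v}"
    by (metis subspace_scaleR[OF subspace_span] span_scale span_base singletonI)
qed

lemma closed_subspace_span_singleton: "closed_subspace (span {v})"
proof (cases "v = 0")
  case True
  then show ?thesis by (simp add: closed_subspace_def)
next
  case False
  have bl: "bounded_linear (\<lambda>k. scale k v)"
    by (rule bounded_linear_intro[where K="norm v"])
      (simp_all add: scale_left_distrib norm_scale scaleR_scale scaleR_conv_of_real)
  have "closed {x. (norm v)\<^sup>2 *\<^sub>R x = scale (ip x v) v}"
    by (intro closed_Collect_eq continuous_intros
        bounded_linear.continuous_on[OF bl] bounded_linear.continuous_on[OF bounded_linear_ip_left])
  then show ?thesis
    by (simp add: closed_subspace_def subspace_span flip: in_span_singleton_iff[OF False])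
qed

lemma proj_span_singleton:
  assumes "v \<noteq> 0"
  shows "proj (span {v}) x = (1 / (norm v)\<^sup>2) *\<^sub>R scale (ip x v) v"
proof (rule proj_eqI[OF closed_subspace_span_singleton])
  show "(1 / (norm v)\<^sup>2) *\<^sub>R scale (ip x v) v \<in> span {v}"
    by (intro subspace_scaleR subspace_span span_scale span_base) simp
  show "x - (1 / (norm v)\<^sup>2) *\<^sub>R scale (ip x v) v \<in> orth_compl (span {v})"
    using assms by (auto simp: orth_compl_def span_singleton ip_scale_right ip_diff_left
        ip_scaleR_left ip_scale_left ip_self)
qed

text \<open>With weight \<open>norm v\<close>, the fusion term of the line through \<open>v\<close>
  is exactly the vector frame term of \<open>v\<close>, also for \<open>v = 0\<close>. Frame and
  Bessel conditions therefore translate without loss of constants.\<close>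

lemma norm_proj_span_singleton:
  "(norm v)\<^sup>2 * (norm (proj (span {v}) x))\<^sup>2 = (norm (ip x v))\<^sup>2"
proof (cases "v = 0")
  case False
  then show ?thesis
    by (simp add: proj_span_singleton norm_scale power_mult_distrib power_divide power2_eq_square)
qed simp

lemma fusion_sequence_span_singleton: "fusion_sequence I (\<lambda>i. span {v i}) (\<lambda>i. norm (v i))"
  by (simp add: fusion_sequence_def closed_subspace_span_singleton span_singleton_eq_0_iff)

lemma vector_frame_fusion_frame:
  "vector_frame I v \<Longrightarrow> fusion_frame I (\<lambda>i. span {v i}) (\<lambda>i. norm (v i))"
  by (simp add: vector_frame_def fusion_frame_def fusion_sequence_span_singleton
      norm_proj_span_singleton)

lemma bessel_sequence_bessel_fusion_sequence:
  "bessel_sequence I v \<Longrightarrow> bessel_fusion_sequence I (\<lambda>i. span {v i}) (\<lambda>i. norm (v i))"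
  by (simp add: bessel_sequence_def bessel_fusion_sequence_def fusion_sequence_span_singleton
      norm_proj_span_singleton)

text \<open>Cauchy-Schwarz gives the upper bound, and the norm is attained at
  \<open>u\<close>.\<close>

lemma onorm_rank_one:
  assumes "u \<noteq> 0" "v \<noteq> 0"
  shows "onorm (\<lambda>x. (1 / (norm u * norm v)) *\<^sub>R scale (ip x u) v) = 1" (is "onorm ?Q = 1")
proof (rule antisym)
  have norm_Q: "norm (?Q x) = norm (ip x u) / norm u" for x
    using assms by (simp add: norm_scale)
  have le: "norm (?Q x) \<le> 1 * norm x" for x
    unfolding norm_Q using assms Cauchy_Schwarz[of x u] by (simp add: divide_le_eq)
  then show "onorm ?Q \<le> 1" by (intro onorm_bound) auto
  have "bounded_linear ?Q"
    by (rule bounded_linear_intro[where K=1])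
      (use le in \<open>simp_all add: ip_add_left ip_scaleR_left scale_left_distrib scaleR_add_right
        scaleR_scale mult_ac\<close>)
  from onorm[OF this, of u] show "1 \<le> onorm ?Q"
    unfolding norm_Q norm_ip_self using assms by (simp add: power2_eq_square)
qed

theorem dual_frame_ff_dual:
  assumes D: "dual_frame I \<psi> \<phi>"
  shows "ff_dual I (\<lambda>i. span {\<psi> i}) (\<lambda>i. norm (\<psi> i)) (\<lambda>i. span {\<phi> i}) (\<lambda>i. norm (\<phi> i))"
proof -
  \<comment> \<open>The rank-one operator of the dual frame expansion, normalised to norm one; the
    weights restore the factor. If one of the vectors is zero, division by zero makes
    \<open>Q i\<close> the zero operator, as suits a null index.\<close>
  define Q where "Q i x = (1 / (norm (\<phi> i) * norm (\<psi> i))) *\<^sub>R scale (ip x (\<phi> i)) (\<psi> i)" for i x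
  have "bounded_op (Q i)" for i
  proof (rule bounded_opI[where K=1])
    show "norm (Q i x) \<le> norm x * 1" for x
      using Cauchy_Schwarz[of x "\<phi> i"] by (simp add: Q_def norm_scale divide_le_eq)
  qed (simp_all add: Q_def ip_add_left ip_scale_left scale_left_distrib scaleR_add_right scaleR_scale
      mult_ac)
  moreover have "Q i x = 0" if "x \<in> orth_compl (span {\<phi> i})" for i x
    using that span_base[of "\<phi> i" "{\<phi> i}"] by (auto simp: orth_compl_def Q_def)
  moreover have "Q i x \<in> span {\<psi> i}" for i x
    unfolding Q_def by (intro subspace_scaleR subspace_span span_scale span_base) simp
  moreover have "onorm (Q i) = 1" if "\<phi> i \<noteq> 0" "\<psi> i \<noteq> 0" for i
    using onorm_rank_one[OF that] by (simp add: Q_def[abs_def])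
  moreover have "(norm (\<phi> i) * norm (\<psi> i)) *\<^sub>R Q i x = scale (ip x (\<phi> i)) (\<psi> i)" for i x
    by (cases "\<phi> i = 0 \<or> \<psi> i = 0") (auto simp: Q_def)
  ultimately have "ff_dual_ops I (\<lambda>i. span {\<psi> i}) (\<lambda>i. norm (\<psi> i))
      (\<lambda>i. span {\<phi> i}) (\<lambda>i. norm (\<phi> i)) Q"
    using D by (auto simp: ff_dual_ops_def dual_frame_def null_indices_def span_singleton_eq_0_iff)
  then show ?thesis
    using D vector_frame_fusion_frame bessel_sequence_bessel_fusion_sequence
    by (auto simp: ff_dual_def dual_frame_def)
qed

section \<open>From FF-duals back to dual frames\<close>

lemma subspace_dim_le_1_eq_span:
  assumes W: "subspace W" "finite_dim W" "dim W \<in> {0, 1}" and v: "v \<in> W" "v \<noteq> 0"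
  shows "W = span {v}"
proof
  show "span {v} \<subseteq> W"
    using W(1) v(1) by (intro span_minimal) auto
  obtain B where B: "B \<subseteq> W" "independent B" "W \<subseteq> span B" "card B = dim W"
    using basis_exists by blast
  obtain C where "finite C" "W \<subseteq> span C" using W(2) by (auto simp: finite_dim_def)
  \<comment> \<open>Finiteness gives the cardinality its meaning: \<open>card B = 0\<close> also
    holds for infinite \<open>B\<close>.\<close>
  then have "finite B" using independent_span_bound[of C B] B by auto
  then obtain b where "B \<subseteq> {b}"
    using B(4) W(3) by (auto simp: card_Suc_eq)
  then have Wb: "W \<subseteq> span {b}" using B(3) span_mono by blast
  then obtain k where k: "v = scale k b" using v by (auto simp: span_singleton)
  then have "k \<noteq> 0" using v by auto
  then have "b = scale (inverse k) v" using k by simp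
  then have "span {b} \<subseteq> span {v}"
    by (intro span_minimal) (auto intro: span_scale span_base)
  then show "W \<subseteq> span {v}" using Wb by blast
qed

lemma fusion_sequence_selection:
  assumes W: "fusion_sequence I W c"
  shows "\<exists>v. \<forall>i\<in>I. v i \<in> W i \<and> norm (v i) = c i"
proof (rule bchoice, rule ballI)
  fix i assume i: "i \<in> I"
  have sub: "subspace (W i)" by (rule closed_subspaceD[OF fusion_sequence_closed[OF W i]])
  show "\<exists>v. v \<in> W i \<and> norm v = c i"
  proof (cases "c i = 0")
    case True
    then show ?thesis using subspace_0[OF sub] by auto
  next
    case False
    then have "W i \<noteq> {0}" using fusion_sequence_trivial[OF W i] by simp
    then obtain w where w: "w \<in> W i" "w \<noteq> 0" using subspace_0[OF sub] by auto
    have "(c i / norm w) *\<^sub>R w \<in> W i" by (rule subspace_scaleR[OF sub w(1)])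
    moreover have "norm ((c i / norm w) *\<^sub>R w) = c i"
      using w fusion_sequence_nonneg[OF W i] by simp
    ultimately show ?thesis by blast
  qed
qed

text \<open>Each \<open>W i\<close> is spanned by a vector \<open>\<phi> i\<close> of norm
  \<open>c i\<close>, so \<open>Q i\<close> is determined by its value at \<open>\<phi> i\<close>,
  and a multiple of that value serves as \<open>\<psi> i\<close>.\<close>

theorem ff_dual_dual_frame:
  assumes dim: "\<And>i. i \<in> I \<Longrightarrow> finite_dim (W i) \<and> dim (W i) \<in> {0, 1}"
    and D: "ff_dual I V d W c"
  shows "\<exists>\<phi> \<psi>. (\<forall>i\<in>I. \<phi> i \<in> W i \<and> \<psi> i \<in> V i \<and> norm (\<phi> i) = c i \<and> norm (\<psi> i) = d i) \<and>
    dual_frame I \<psi> \<phi>"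
proof -
  obtain Q where Q: "ff_dual_ops I V d W c Q" using D by (auto simp: ff_dual_def)
  have WF: "fusion_frame I W c" and VB: "bessel_fusion_sequence I V d"
    using D by (auto simp: ff_dual_def)
  have W: "fusion_sequence I W c" and V: "fusion_sequence I V d"
    using WF VB by (auto simp: bessel_fusion_sequence_def fusion_frame_def)
  obtain \<phi> where \<phi>: "\<And>i. i \<in> I \<Longrightarrow> \<phi> i \<in> W i" "\<And>i. i \<in> I \<Longrightarrow> norm (\<phi> i) = c i"
    using fusion_sequence_selection[OF W] by blast
  obtain \<eta> where \<eta>: "\<And>i. i \<in> I \<Longrightarrow> \<eta> i \<in> V i" "\<And>i. i \<in> I \<Longrightarrow> norm (\<eta> i) = d i"
    using fusion_sequence_selection[OF V] by blast
  \<comment> \<open>The factor \<open>d i / c i\<close> is forced by matching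
    \<open>(c i * d i) *\<^sub>R Q i x\<close> with the rank-one form of \<open>Q i\<close>. At null
    indices any vector of \<open>V i\<close> with norm \<open>d i\<close> will do, as both sides of
    the matching vanish.\<close>
  define \<psi> where "\<psi> i = (if i \<in> null_indices I V W then \<eta> i else (d i / c i) *\<^sub>R Q i (\<phi> i))" for i
  have W_span: "W i = span {\<phi> i}" if i: "i \<in> I" for i
  proof (cases "c i = 0")
    case True
    then show ?thesis
      using fusion_sequence_trivial[OF W i] \<phi>(2)[OF i] by simp
  next
    case False
    then have "\<phi> i \<noteq> 0" using \<phi>(2)[OF i] by auto
    then show ?thesis
      using dim[OF i] \<phi>(1)[OF i] closed_subspaceD[OF fusion_sequence_closed[OF W i]]
      by (intro subspace_dim_le_1_eq_span) auto
  qed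
  have \<psi>: "\<psi> i \<in> V i \<and> norm (\<psi> i) = d i \<and>
      (\<forall>x. scale (ip x (\<phi> i)) (\<psi> i) = (c i * d i) *\<^sub>R Q i x)" if i: "i \<in> I" for i
  proof (cases "i \<in> null_indices I V W")
    case True
    then have "c i = 0 \<or> d i = 0"
      using fusion_sequence_trivial[OF W i] fusion_sequence_trivial[OF V i]
      by (auto simp: null_indices_def)
    then have "\<phi> i = 0 \<or> \<psi> i = 0"
      using \<phi>(2)[OF i] \<eta>(2)[OF i] True by (auto simp: \<psi>_def)
    then show ?thesis
      using \<open>c i = 0 \<or> d i = 0\<close> True \<eta> i by (auto simp: \<psi>_def)
  next
    case False
    then have "c i \<noteq> 0"
      using fusion_sequence_trivial[OF W i] i by (auto simp: null_indices_def)
    then have c: "c i > 0" using fusion_sequence_nonneg[OF W i] by simp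
    then have \<phi>0: "\<phi> i \<noteq> 0" using \<phi>(2)[OF i] by auto
    have Qi: "bounded_op (Q i)" "orth_compl (W i) \<subseteq> {x. Q i x = 0}" "onorm (Q i) = 1"
      "range (Q i) \<subseteq> V i"
      using Q i False by (auto simp: ff_dual_ops_def)
    note bl = bounded_op_bounded_linear[OF Qi(1)]
    have Q_eq: "Q i x = (1 / (c i)\<^sup>2) *\<^sub>R scale (ip x (\<phi> i)) (Q i (\<phi> i))" for x
    proof -
      have "Q i x = Q i (proj (W i) x)"
        by (rule bounded_op_proj_absorb[OF Qi(1) fusion_sequence_closed[OF W i] Qi(2), symmetric])
      then show ?thesis
        by (simp add: W_span[OF i] proj_span_singleton[OF \<phi>0] bounded_op_scaleR[OF Qi(1)]
            bounded_op_scale[OF Qi(1)] \<phi>(2)[OF i])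
    qed
    \<comment> \<open>A rank-one operator attains its norm on the line it depends on, so
      \<open>onorm (Q i) = 1\<close> forces \<open>norm (Q i (\<phi> i)) = c i\<close>.\<close>
    have "norm (Q i x) \<le> (norm (Q i (\<phi> i)) / c i) * norm x" for x
    proof -
      have "norm (Q i x) = norm (ip x (\<phi> i)) * norm (Q i (\<phi> i)) / (c i)\<^sup>2"
        using c by (subst Q_eq) (simp add: norm_scale)
      also have "\<dots> \<le> (norm x * c i) * norm (Q i (\<phi> i)) / (c i)\<^sup>2"
        using Cauchy_Schwarz[of x "\<phi> i"] \<phi>(2)[OF i] by (intro divide_right_mono mult_right_mono) auto
      finally show ?thesis using c by (simp add: power2_eq_square mult_ac)
    qed
    then have "onorm (Q i) \<le> norm (Q i (\<phi> i)) / c i"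
      using c by (intro onorm_bound) auto
    then have "norm (Q i (\<phi> i)) \<ge> c i" using c Qi(3) by (simp add: field_simps)
    moreover have "norm (Q i (\<phi> i)) \<le> c i"
      using onorm[OF bl, of "\<phi> i"] Qi(3) \<phi>(2)[OF i] by simp
    ultimately have "norm (\<psi> i) = d i"
      using c False fusion_sequence_nonneg[OF V i] by (simp add: \<psi>_def)
    moreover have "\<psi> i \<in> V i"
      using False Qi(4) subspace_scaleR[OF closed_subspaceD[OF fusion_sequence_closed[OF V i]]]
      by (auto simp: \<psi>_def)
    moreover have "scale (ip x (\<phi> i)) (\<psi> i) = (c i * d i) *\<^sub>R Q i x" for x
    proof -
      have "scale (ip x (\<phi> i)) (\<psi> i) = (d i / c i) *\<^sub>R scale (ip x (\<phi> i)) (Q i (\<phi> i))"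
        using False by (simp add: \<psi>_def scaleR_scale mult.commute flip: scale_of_real)
      also have "\<dots> = (c i * d i) *\<^sub>R Q i x"
        using c by (subst Q_eq[of x]) (simp add: power2_eq_square)
      finally show ?thesis .
    qed
    ultimately show ?thesis by simp
  qed
  have "(norm (ip x (\<phi> i)))\<^sup>2 = (c i)\<^sup>2 * (norm (proj (W i) x))\<^sup>2" if i: "i \<in> I" for i x
    using norm_proj_span_singleton[of "\<phi> i" x] by (simp add: W_span[OF i] \<phi>(2)[OF i])
  then have "vector_frame I \<phi> \<longleftrightarrow> (\<exists>\<alpha>>0. \<exists>\<beta>>0. \<forall>x.
      (\<lambda>i. (c i)\<^sup>2 * (norm (proj (W i) x))\<^sup>2) summable_on I \<and>
      \<alpha> * (norm x)\<^sup>2 \<le> (\<Sum>\<^sub>\<infinity>i\<in>I. (c i)\<^sup>2 * (norm (proj (W i) x))\<^sup>2) \<and>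
      (\<Sum>\<^sub>\<infinity>i\<in>I. (c i)\<^sup>2 * (norm (proj (W i) x))\<^sup>2) \<le> \<beta> * (norm x)\<^sup>2)"
    unfolding vector_frame_def by (simp cong: summable_on_cong infsum_cong)
  then have "vector_frame I \<phi>" using WF by (simp add: fusion_frame_def)
  moreover have "bessel_sequence I \<psi>"
    unfolding bessel_sequence_def
  proof (rule bessel_by_comparison[OF VB, where K=1 and L=1 and h="\<lambda>x. x"])
    fix x i assume i: "i \<in> I"
    have "norm (ip x (\<psi> i)) = norm (ip (proj (V i) x) (\<psi> i))"
      using ip_proj_left[OF fusion_sequence_closed[OF V i]] \<psi>[OF i] by simp
    also have "\<dots> \<le> d i * norm (proj (V i) x)"
      using Cauchy_Schwarz[of "proj (V i) x" "\<psi> i"] \<psi>[OF i] by (simp add: mult.commute)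
    finally show "0 \<le> (norm (ip x (\<psi> i)))\<^sup>2 \<and>
        (norm (ip x (\<psi> i)))\<^sup>2 \<le> 1 * (d i * norm (proj (V i) x))\<^sup>2"
      by (simp add: power_mono)
  qed auto
  moreover have "((\<lambda>i. scale (ip x (\<phi> i)) (\<psi> i)) has_sum x) I" for x
  proof -
    have "((\<lambda>i. (c i * d i) *\<^sub>R Q i x) has_sum x) I" using Q by (simp add: ff_dual_ops_def)
    then show ?thesis using \<psi> by (simp cong: has_sum_cong)
  qed
  ultimately show ?thesis
    using \<phi> \<psi> by (intro exI[of _ \<phi>] exI[of _ \<psi>]) (simp add: dual_frame_def)
qed

section \<open>The fusion frame operator and the canonical dual\<close>

text \<open>Connects the definition through the abstract adjoint with the concrete series: the limit
  of the series satisfies the adjoint equation, and only one vector does, by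
  \<open>ip_ext\<close>.\<close>

lemma fusion_frame_op_has_sum:
  assumes W: "bessel_fusion_sequence I W c"
  shows "((\<lambda>i. (c i)\<^sup>2 *\<^sub>R proj (W i) y) has_sum fusion_frame_op I W c y) I"
proof -
  have Wf: "fusion_sequence I W c" and sm: "\<And>x. (\<lambda>i. (c i * norm (proj (W i) x))\<^sup>2) summable_on I"
    using bessel_fusion_sequenceE[OF W] by metis+
  have "(\<lambda>i. (norm (c i *\<^sub>R proj (W i) y))\<^sup>2) summable_on I"
    using sm[of y] by (simp add: power_mult_distrib)
  from synthesis_summable[OF W this]
  obtain L where L: "((\<lambda>i. c i *\<^sub>R proj (W i) (c i *\<^sub>R proj (W i) y)) has_sum L) I"
    by (auto simp: summable_on_def)
  have "c i *\<^sub>R proj (W i) (c i *\<^sub>R proj (W i) y) = (c i)\<^sup>2 *\<^sub>R proj (W i) y" if i: "i \<in> I" for i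
  proof -
    have "c i *\<^sub>R proj (W i) y \<in> W i"
      using fusion_sequence_closed[OF Wf i] by (intro subspace_scaleR closed_subspaceD proj_in)
    then show ?thesis
      by (simp add: proj_id[OF fusion_sequence_closed[OF Wf i]] power2_eq_square)
  qed
  with L have L': "((\<lambda>i. (c i)\<^sup>2 *\<^sub>R proj (W i) y) has_sum L) I"
    by (simp cong: has_sum_cong)
  have adj: "ip x L = ell2_ip I (analysis_op I W c x) (analysis_op I W c y)" for x
  proof -
    have "((\<lambda>i. ip x ((c i)\<^sup>2 *\<^sub>R proj (W i) y)) has_sum ip x L) I"
      by (rule has_sum_bounded_linear[OF bounded_linear_ip_right L'])
    moreover have "ip x ((c i)\<^sup>2 *\<^sub>R proj (W i) y) =
        ip (analysis_op I W c x i) (analysis_op I W c y i)" if i: "i \<in> I" for i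
      using i ip_proj_left[OF fusion_sequence_closed[OF Wf i] proj_in[OF fusion_sequence_closed[OF Wf i]]]
      by (simp add: analysis_op_def ip_scaleR_left ip_scaleR_right power2_eq_square)
    ultimately have "((\<lambda>i. ip (analysis_op I W c x i) (analysis_op I W c y i)) has_sum ip x L) I"
      by (simp cong: has_sum_cong)
    then show ?thesis
      unfolding ell2_ip_def by (rule infsumI[symmetric])
  qed
  have "fusion_frame_op I W c y = L"
    unfolding fusion_frame_op_def o_def ell2_adjoint_def
  proof (rule the_equality)
    fix z assume "\<forall>x. ip x z = ell2_ip I (analysis_op I W c x) (analysis_op I W c y)"
    then show "z = L" using adj by (intro ip_ext) simp
  qed (use adj in simp)
  with L' show ?thesis by simp
qed

lemma fusion_frame_op_self_adjoint:
  assumes W: "bessel_fusion_sequence I W c"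
  shows "ip (fusion_frame_op I W c x) y = ip x (fusion_frame_op I W c y)"
proof -
  have Wf: "fusion_sequence I W c" using W by (simp add: bessel_fusion_sequence_def)
  have "((\<lambda>i. ip ((c i)\<^sup>2 *\<^sub>R proj (W i) x) y) has_sum ip (fusion_frame_op I W c x) y) I"
    by (rule has_sum_bounded_linear[OF bounded_linear_ip_left fusion_frame_op_has_sum[OF W]])
  moreover have "((\<lambda>i. ip x ((c i)\<^sup>2 *\<^sub>R proj (W i) y)) has_sum ip x (fusion_frame_op I W c y)) I"
    by (rule has_sum_bounded_linear[OF bounded_linear_ip_right fusion_frame_op_has_sum[OF W]])
  moreover have "ip ((c i)\<^sup>2 *\<^sub>R proj (W i) x) y = ip x ((c i)\<^sup>2 *\<^sub>R proj (W i) y)" if "i \<in> I" for i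
    by (simp add: ip_scaleR_left ip_scaleR_right
        ip_proj_self_adjoint[OF fusion_sequence_closed[OF Wf that]])
  ultimately have "((\<lambda>i. ip x ((c i)\<^sup>2 *\<^sub>R proj (W i) y)) has_sum ip (fusion_frame_op I W c x) y) I"
    "((\<lambda>i. ip x ((c i)\<^sup>2 *\<^sub>R proj (W i) y)) has_sum ip x (fusion_frame_op I W c y)) I"
    by (simp_all cong: has_sum_cong)
  then show ?thesis by (rule has_sum_unique)
qed

text \<open>Additivity and homogeneity follow from self-adjointness, without manipulating series.
  The norm bound comes from Cauchy-Schwarz applied to the series for
  \<open>ip (?S y) (?S y)\<close>, with the Bessel bound used at \<open>y\<close> and at
  \<open>?S y\<close>.\<close>

lemma bounded_op_fusion_frame_op:
  assumes W: "bessel_fusion_sequence I W c"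
  shows "bounded_op (fusion_frame_op I W c)"
proof -
  let ?S = "fusion_frame_op I W c"
  note sum = fusion_frame_op_has_sum[OF W] and sa = fusion_frame_op_self_adjoint[OF W]
  obtain \<beta> where \<beta>: "\<beta> > 0" and Wf: "fusion_sequence I W c"
    and sm: "\<And>x. (\<lambda>i. (c i * norm (proj (W i) x))\<^sup>2) summable_on I"
    and bd: "\<And>x. (\<Sum>\<^sub>\<infinity>i\<in>I. (c i * norm (proj (W i) x))\<^sup>2) \<le> \<beta> * (norm x)\<^sup>2"
    using bessel_fusion_sequenceE[OF W] by metis
  show ?thesis
  proof (rule bounded_opI[where K=\<beta>])
    show "?S (x + y) = ?S x + ?S y" for x y
      by (rule ip_ext) (simp add: ip_add_right flip: sa)
    show "?S (scale a x) = scale a (?S x)" for a x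
      by (rule ip_ext) (simp add: ip_scale_right flip: sa)
    show "norm (?S y) \<le> norm y * \<beta>" for y
    proof (cases "?S y = 0")
      case False
      have s: "((\<lambda>i. ip ((c i)\<^sup>2 *\<^sub>R proj (W i) y) (?S y)) has_sum ip (?S y) (?S y)) I"
        by (rule has_sum_bounded_linear[OF bounded_linear_ip_left sum])
      have "norm (ip ((c i)\<^sup>2 *\<^sub>R proj (W i) y) (?S y)) \<le>
          (c i * norm (proj (W i) y)) * (c i * norm (proj (W i) (?S y)))" if i: "i \<in> I" for i
      proof -
        have "ip (proj (W i) y) (?S y) = ip (proj (W i) y) (proj (W i) (?S y))"
          using ip_proj_right[OF fusion_sequence_closed[OF Wf i] proj_in[OF fusion_sequence_closed[OF Wf i]]]
          by simp
        then have "norm (ip ((c i)\<^sup>2 *\<^sub>R proj (W i) y) (?S y)) \<le>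
            (c i)\<^sup>2 * (norm (proj (W i) y) * norm (proj (W i) (?S y)))"
          by (simp add: ip_scaleR_left norm_mult norm_power mult_left_mono Cauchy_Schwarz)
        then show ?thesis by (simp add: power2_eq_square mult_ac)
      qed
      from has_sum_Cauchy_Schwarz[OF s this sm sm]
      have "((norm (?S y))\<^sup>2)\<^sup>2 \<le> (\<Sum>\<^sub>\<infinity>i\<in>I. (c i * norm (proj (W i) y))\<^sup>2) *
          (\<Sum>\<^sub>\<infinity>i\<in>I. (c i * norm (proj (W i) (?S y)))\<^sup>2)"
        by (simp add: norm_ip_self)
      also have "\<dots> \<le> (\<beta> * (norm y)\<^sup>2) * (\<beta> * (norm (?S y))\<^sup>2)"
        using \<beta> by (intro mult_mono bd infsum_nonneg) auto
      finally have "(norm (?S y))\<^sup>2 * (norm (?S y))\<^sup>2 \<le> (norm y * \<beta>)\<^sup>2 * (norm (?S y))\<^sup>2"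
        by (simp add: power2_eq_square mult_ac)
      then have "(norm (?S y))\<^sup>2 \<le> (norm y * \<beta>)\<^sup>2"
        by (rule mult_right_le_imp_le) (use False in simp)
      then show ?thesis
        by (rule power2_le_imp_le) (use \<beta> in simp)
    qed (use \<beta> in simp)
  qed
qed

text \<open>The quadratic form \<open>ip (?S x) x\<close> equals the frame sum at \<open>x\<close>,
  so the lower frame bound and Cauchy-Schwarz give the estimate with the same
  \<open>\<alpha>\<close>.\<close>

lemma fusion_frame_op_bounded_below:
  assumes W: "fusion_frame I W c"
  shows "\<exists>\<alpha>>0. \<forall>x. \<alpha> * norm x \<le> norm (fusion_frame_op I W c x)"
proof -
  let ?S = "fusion_frame_op I W c"
  have Wf: "fusion_sequence I W c" using W by (simp add: fusion_frame_def)
  obtain \<alpha> where \<alpha>: "\<alpha> > 0"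
    and sm: "\<And>x. (\<lambda>i. (c i)\<^sup>2 * (norm (proj (W i) x))\<^sup>2) summable_on I"
    and lower: "\<And>x. \<alpha> * (norm x)\<^sup>2 \<le> (\<Sum>\<^sub>\<infinity>i\<in>I. (c i)\<^sup>2 * (norm (proj (W i) x))\<^sup>2)"
    using W unfolding fusion_frame_def by blast
  have "\<alpha> * norm x \<le> norm (?S x)" for x
  proof (cases "x = 0")
    case False
    let ?s = "\<Sum>\<^sub>\<infinity>i\<in>I. (c i)\<^sup>2 * (norm (proj (W i) x))\<^sup>2"
    have "((\<lambda>i. ip ((c i)\<^sup>2 *\<^sub>R proj (W i) x) x) has_sum ip (?S x) x) I"
      by (rule has_sum_bounded_linear[OF bounded_linear_ip_left
            fusion_frame_op_has_sum[OF fusion_frame_imp_bessel[OF W]]])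
    moreover have "ip ((c i)\<^sup>2 *\<^sub>R proj (W i) x) x = of_real ((c i)\<^sup>2 * (norm (proj (W i) x))\<^sup>2)"
      if i: "i \<in> I" for i
      using ip_proj_right[OF fusion_sequence_closed[OF Wf i] proj_in[OF fusion_sequence_closed[OF Wf i]],
          of x x]
      by (simp add: ip_scaleR_left ip_self)
    ultimately have "((\<lambda>i. of_real ((c i)\<^sup>2 * (norm (proj (W i) x))\<^sup>2)) has_sum ip (?S x) x) I"
      by (simp cong: has_sum_cong)
    moreover have "((\<lambda>i. of_real ((c i)\<^sup>2 * (norm (proj (W i) x))\<^sup>2)) has_sum (of_real ?s :: 'k)) I"
      by (rule has_sum_bounded_linear[OF bounded_linear_of_real has_sum_infsum[OF sm]])
    ultimately have "ip (?S x) x = of_real ?s" by (rule has_sum_unique)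
    then have "?s \<le> norm (?S x) * norm x"
      using Cauchy_Schwarz[of "?S x" x] by simp
    then have "(\<alpha> * norm x) * norm x \<le> norm (?S x) * norm x"
      using lower[of x] by (simp add: power2_eq_square mult_ac)
    then show ?thesis by (rule mult_right_le_imp_le) (use False in simp)
  qed simp
  then show ?thesis using \<alpha> by blast
qed

text \<open>Being bounded below makes the operator injective with closed range. Self-adjointness
  makes the range dense: if \<open>w\<close> is orthogonal to the range, testing against
  \<open>?S (?S w)\<close> gives \<open>?S w = 0\<close>.\<close>

lemma fusion_frame_op_bij:
  assumes W: "fusion_frame I W c"
  shows "bij (fusion_frame_op I W c)"
proof -
  let ?S = "fusion_frame_op I W c"
  note S = bounded_op_fusion_frame_op[OF fusion_frame_imp_bessel[OF W]]
  note bl = bounded_op_bounded_linear[OF S]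
  obtain \<alpha> where \<alpha>: "\<alpha> > 0" "\<And>x. \<alpha> * norm x \<le> norm (?S x)"
    using fusion_frame_op_bounded_below[OF W] by blast
  have ker: "x = 0" if "?S x = 0" for x
    using \<alpha>(2)[of x] \<alpha>(1) that by (simp add: mult_le_0_iff)
  have "inj ?S"
    using ker by (simp add: linear_injective_0[OF bounded_linear.linear[OF bl]])
  moreover have "surj ?S"
  proof -
    have "complete (range ?S)"
      by (rule complete_isometric_image[OF \<alpha>(1) _ bl])
        (use \<alpha>(2) in \<open>auto simp: complete_eq_closed\<close>)
    moreover have "subspace (range ?S)"
      by (rule subspaceI)
        (auto simp flip: bounded_op_add[OF S] bounded_op_scale[OF S]
          intro: range_eqI[of _ _ 0] simp: linear_0[OF bounded_linear.linear[OF bl]])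
    ultimately have R: "closed_subspace (range ?S)"
      by (simp add: closed_subspace_def complete_eq_closed)
    have "y \<in> range ?S" for y
    proof (rule orth_compl_orth_compl[OF R])
      fix w assume "w \<in> orth_compl (range ?S)"
      then have "ip w (?S (?S w)) = 0" by (simp add: orth_compl_def)
      then have "?S w = 0"
        using fusion_frame_op_self_adjoint[OF fusion_frame_imp_bessel[OF W], of w "?S w"] by simp
      then show "ip w y = 0" using ker[of w] by simp
    qed
    then show ?thesis by blast
  qed
  ultimately show ?thesis by (rule bijI)
qed

section \<open>The inverse frame operator and norms of restrictions\<close>

lemma bounded_op_inv_fusion_frame_op:
  assumes W: "fusion_frame I W c"
  shows "bounded_op (inv (fusion_frame_op I W c))"
proof -
  let ?S = "fusion_frame_op I W c"
  note S = bounded_op_fusion_frame_op[OF fusion_frame_imp_bessel[OF W]]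
  have inj: "inj ?S" and S_inv: "\<And>x. ?S (inv ?S x) = x"
    using fusion_frame_op_bij[OF W] by (auto simp: bij_def surj_f_inv_f)
  obtain \<alpha> where \<alpha>: "\<alpha> > 0" "\<And>x. \<alpha> * norm x \<le> norm (?S x)"
    using fusion_frame_op_bounded_below[OF W] by blast
  show ?thesis
  proof (rule bounded_opI[where K="1 / \<alpha>"])
    show "inv ?S (x + y) = inv ?S x + inv ?S y" for x y
      by (rule injD[OF inj]) (simp add: bounded_op_add[OF S] S_inv)
    show "inv ?S (scale a x) = scale a (inv ?S x)" for a x
      by (rule injD[OF inj]) (simp add: bounded_op_scale[OF S] S_inv)
    show "norm (inv ?S x) \<le> norm x * (1 / \<alpha>)" for x
      using \<alpha>(2)[of "inv ?S x"] \<alpha>(1) by (simp add: S_inv field_simps)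
  qed
qed

text \<open>At \<open>w = 0\<close> the quotient is \<open>0 / 0 = 0\<close>, so including 0 in the
  supremum does no harm and gives the value 0 on the trivial subspace. The last bound says that
  \<open>onorm_on A W\<close> is the least nonnegative Lipschitz constant of \<open>A\<close> on
  \<open>W\<close>.\<close>

lemma onorm_on_bounds:
  fixes A :: "'a \<Rightarrow> 'a"
  assumes A: "bounded_op A" and W: "0 \<in> W"
  shows "w \<in> W \<Longrightarrow> norm (A w) \<le> onorm_on A W * norm w"
    and "0 \<le> onorm_on A W" and "onorm_on A W \<le> onorm A"
    and "(\<And>w. w \<in> W \<Longrightarrow> norm (A w) \<le> K * norm w) \<Longrightarrow> K \<ge> 0 \<Longrightarrow> onorm_on A W \<le> K"
proof -
  note bl = bounded_op_bounded_linear[OF A]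
  have bdd: "bdd_above ((\<lambda>x. norm (A x) / norm x) ` W)"
    by (rule bdd_aboveI2) (rule le_onorm[OF bl])
  have upper: "norm (A w) / norm w \<le> onorm_on A W" if "w \<in> W" for w
    unfolding onorm_on_def using that bdd by (rule cSUP_upper)
  show "norm (A w) \<le> onorm_on A W * norm w" if "w \<in> W"
    using upper[OF that] linear_0[OF bounded_linear.linear[OF bl]]
    by (cases "w = 0") (simp_all add: divide_le_eq)
  show "0 \<le> onorm_on A W" using upper[OF W] by simp
  show least: "onorm_on A W \<le> K" if "\<And>w. w \<in> W \<Longrightarrow> norm (A w) \<le> K * norm w" "K \<ge> 0" for K
    unfolding onorm_on_def
  proof (rule cSUP_least)
    show "norm (A w) / norm w \<le> K" if "w \<in> W" for w
      using \<open>w \<in> W \<Longrightarrow> norm (A w) \<le> K * norm w\<close>[OF that] \<open>K \<ge> 0\<close>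
      by (cases "w = 0") (simp_all add: divide_le_eq)
  qed (use W in auto)
  show "onorm_on A W \<le> onorm A"
    by (rule least) (simp_all add: onorm[OF bl] onorm_pos_le[OF bl])
qed

text \<open>
  The projection onto \<open>S\<^sup>-\<^sup>1 W\<close> is dominated by \<open>P\<^sub>W S\<^sup>-\<^sup>1\<close>: writing \<open>P\<^sub>V x = S\<^sup>-\<^sup>1 w\<close> one has
  \<open>\<parallel>P\<^sub>V x\<parallel>\<^sup>2 = \<langle>S\<^sup>-\<^sup>1 w, x\<rangle> = \<langle>w, P\<^sub>W S\<^sup>-\<^sup>1 x\<rangle>\<close>.
\<close>
lemma norm_proj_image_self_adjoint_le:
  assumes S: "bounded_op S" and T_sa: "\<And>x y. ip (T x) y = ip x (T y)"
    and TS: "\<And>x. T (S x) = x" and ST: "\<And>x. S (T x) = x"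
    and W: "closed_subspace W" and V: "closed_subspace (T ` W)"
  shows "norm (proj (T ` W) x) \<le> onorm S * norm (proj W (T x))"
proof -
  let ?p = "proj (T ` W) x"
  note bl = bounded_op_bounded_linear[OF S]
  have "?p \<in> T ` W" by (rule proj_in[OF V])
  then have SpW: "S ?p \<in> W" using ST by auto
  have "ip ?p ?p = ip ?p x" by (rule ip_proj_right[OF V proj_in[OF V]])
  also have "\<dots> = ip (S ?p) (T x)" using T_sa[of "S ?p" x] by (simp add: TS)
  also have "\<dots> = ip (S ?p) (proj W (T x))" by (rule ip_proj_right[OF W SpW, symmetric])
  finally have "(norm ?p)\<^sup>2 \<le> norm (S ?p) * norm (proj W (T x))"
    using Cauchy_Schwarz by (metis norm_ip_self)
  also have "\<dots> \<le> (onorm S * norm ?p) * norm (proj W (T x))"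
    by (intro mult_right_mono onorm[OF bl] norm_ge_zero)
  finally have "norm ?p * norm ?p \<le> (onorm S * norm (proj W (T x))) * norm ?p"
    by (simp add: power2_eq_square mult_ac)
  then show ?thesis
    using onorm_pos_le[OF bl] by (cases "?p = 0") (auto dest: mult_right_le_imp_le)
qed

theorem canonical_ff_dual:
  assumes W: "fusion_frame I W c"
  defines "T \<equiv> inv (fusion_frame_op I W c)"
  shows "ff_dual I (\<lambda>i. T ` W i) (\<lambda>i. c i * onorm_on T (W i)) W c"
proof -
  let ?S = "fusion_frame_op I W c"
  note WB = fusion_frame_imp_bessel[OF W]
  have Wf: "fusion_sequence I W c" using W by (simp add: fusion_frame_def)
  note S = bounded_op_fusion_frame_op[OF WB]
  have T: "bounded_op T" unfolding T_def by (rule bounded_op_inv_fusion_frame_op[OF W])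
  note blS = bounded_op_bounded_linear[OF S] and blT = bounded_op_bounded_linear[OF T]
  have ST: "?S (T x) = x" and TS: "T (?S x) = x" for x
    using fusion_frame_op_bij[OF W] by (auto simp: T_def bij_def surj_f_inv_f)
  have T0: "T x = 0 \<longleftrightarrow> x = 0" for x
    by (metis ST blS blT bounded_linear.linear linear_0)
  have T_sa: "ip (T x) y = ip x (T y)" for x y
    using fusion_frame_op_self_adjoint[OF WB, of "T x" "T y"] by (simp add: ST)
  define N where "N i = onorm_on T (W i)" for i
  have clW: "closed_subspace (W i)" if "i \<in> I" for i by (rule fusion_sequence_closed[OF Wf that])
  have W0: "0 \<in> W i" if "i \<in> I" for i using clW[OF that] by (simp add: closed_subspace_def subspace_0)
  have N: "w \<in> W i \<Longrightarrow> norm (T w) \<le> N i * norm w" "0 \<le> N i" "N i \<le> onorm T"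
    "(\<And>w. w \<in> W i \<Longrightarrow> norm (T w) \<le> K * norm w) \<Longrightarrow> K \<ge> 0 \<Longrightarrow> N i \<le> K" if "i \<in> I" for i w K
    using onorm_on_bounds[OF T W0[OF that]] by (auto simp: N_def)
  \<comment> \<open>As a preimage under the bounded operator \<open>?S\<close>, the image inherits
    closedness from \<open>W i\<close>.\<close>
  have image_eq: "T ` W i = ?S -` W i" for i
    using ST TS by (auto simp: image_iff) metis
  have clV: "closed_subspace (T ` W i)" if i: "i \<in> I" for i
    unfolding closed_subspace_def
  proof
    show "subspace (T ` W i)"
      unfolding image_eq using clW[OF i] W0[OF i]
      by (intro subspaceI) (auto simp: closed_subspace_def bounded_op_add[OF S] bounded_op_scale[OF S]
          linear_0[OF bounded_linear.linear[OF blS]] subspace_add subspace_scale)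
    show "closed (T ` W i)"
      unfolding image_eq using clW[OF i] bounded_linear.continuous_on[OF blS continuous_on_id, of UNIV]
      by (intro closed_vimage) (auto simp: closed_subspace_def)
  qed
  have V0: "T ` W i = {0} \<longleftrightarrow> W i = {0}" if i: "i \<in> I" for i
    using W0[OF i] T0 by auto
  have N0: "N i = 0 \<longleftrightarrow> W i = {0}" if i: "i \<in> I" for i
  proof
    assume "N i = 0"
    then have "w = 0" if "w \<in> W i" for w using N(1)[OF i that] T0 by simp
    then show "W i = {0}" using W0[OF i] by auto
  next
    assume "W i = {0}"
    then show "N i = 0" using N(2)[OF i] N(4)[OF i, of 0] T0 by force
  qed
  have Vf: "fusion_sequence I (\<lambda>i. T ` W i) (\<lambda>i. c i * N i)"
    unfolding fusion_sequence_def
    using clV V0 N0 N(2) fusion_sequence_trivial[OF Wf] fusion_sequence_nonneg[OF Wf] by auto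
  have "\<exists>\<beta>>0. \<forall>x. (\<lambda>i. (c i * N i)\<^sup>2 * (norm (proj (T ` W i) x))\<^sup>2) summable_on I \<and>
      (\<Sum>\<^sub>\<infinity>i\<in>I. (c i * N i)\<^sup>2 * (norm (proj (T ` W i) x))\<^sup>2) \<le> \<beta> * (norm x)\<^sup>2"
  proof (rule bessel_by_comparison[OF WB, where K="(onorm T * onorm ?S)\<^sup>2 + 1" and L="onorm T + 1" and h=T])
    fix x i assume i: "i \<in> I"
    have "(c i * N i) * norm (proj (T ` W i) x) \<le> (c i * onorm T) * (onorm ?S * norm (proj (W i) (T x)))"
      using N(2,3)[OF i] fusion_sequence_nonneg[OF Wf i]
      by (intro mult_mono norm_proj_image_self_adjoint_le[OF S T_sa TS ST clW[OF i] clV[OF i]]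
          mult_left_mono mult_nonneg_nonneg onorm_pos_le[OF blT]) auto
    then have "((c i * N i) * norm (proj (T ` W i) x))\<^sup>2 \<le>
        ((onorm T * onorm ?S) * (c i * norm (proj (W i) (T x))))\<^sup>2"
      using N(2)[OF i] fusion_sequence_nonneg[OF Wf i] by (intro power_mono) (auto simp: mult_ac)
    also have "\<dots> \<le> ((onorm T * onorm ?S)\<^sup>2 + 1) * (c i * norm (proj (W i) (T x)))\<^sup>2"
      unfolding power_mult_distrib[of "onorm T * onorm ?S"] by (intro mult_right_mono) auto
    finally show "0 \<le> (c i * N i)\<^sup>2 * (norm (proj (T ` W i) x))\<^sup>2 \<and>
        (c i * N i)\<^sup>2 * (norm (proj (T ` W i) x))\<^sup>2 \<le>
          ((onorm T * onorm ?S)\<^sup>2 + 1) * (c i * norm (proj (W i) (T x)))\<^sup>2"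
      unfolding power_mult_distrib[of "c i * N i", symmetric] by simp
  next
    show "norm (T x) \<le> (onorm T + 1) * norm x" for x
      using onorm[OF blT, of x] by (simp add: distrib_right add_increasing2)
    show "0 < onorm T + 1" using onorm_pos_le[OF blT] by linarith
    show "0 < (onorm T * onorm ?S)\<^sup>2 + 1" by (simp add: add_nonneg_pos)
  qed
  then have VB: "bessel_fusion_sequence I (\<lambda>i. T ` W i) (\<lambda>i. c i * N i)"
    using Vf by (simp add: bessel_fusion_sequence_def)
  \<comment> \<open>For \<open>W i = {0}\<close> both \<open>N i\<close> and \<open>1 / N i\<close>
    are 0, so \<open>Q i\<close> is the zero operator.\<close>
  define Q where "Q i x = (1 / N i) *\<^sub>R T (proj (W i) x)" for i x
  have Q_le: "norm (Q i x) \<le> norm x * 1" if i: "i \<in> I" for i x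
  proof -
    have "norm (T (proj (W i) x)) \<le> N i * norm x"
      by (rule order_trans[OF N(1)[OF i proj_in[OF clW[OF i]]]])
        (intro mult_left_mono norm_proj_le clW N(2) i)
    then show ?thesis
      using N(2)[OF i] by (cases "N i = 0") (simp_all add: Q_def divide_le_eq mult.commute)
  qed
  have Q: "bounded_op (Q i)" if i: "i \<in> I" for i
    by (rule bounded_opI[OF _ _ Q_le[OF i]])
      (simp_all add: Q_def proj_add[OF clW[OF i]] proj_scale[OF clW[OF i]] bounded_op_add[OF T]
        bounded_op_scale[OF T] scaleR_add_right scaleR_scale scale_right_distrib mult.commute
        flip: scale_of_real)
  have Q_norm: "onorm (Q i) = 1" if i: "i \<in> I" and "W i \<noteq> {0}" for i
  proof (rule antisym)
    have Npos: "N i > 0" using N0[OF i] N(2)[OF i] that by auto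
    show "onorm (Q i) \<le> 1"
      using Q_le[OF i] by (intro onorm_bound) auto
    note blQ = bounded_op_bounded_linear[OF Q[OF i]]
    \<comment> \<open>On \<open>W i\<close> the operator \<open>T\<close> equals \<open>N i\<close>
      times \<open>Q i\<close>, so \<open>N i * onorm (Q i)\<close> is an admissible constant there
      and \<open>N i\<close> is the least one.\<close>
    have "N i \<le> N i * onorm (Q i)"
    proof (rule N(4)[OF i])
      show "norm (T w) \<le> N i * onorm (Q i) * norm w" if "w \<in> W i" for w
        using onorm[OF blQ, of w] Npos by (simp add: Q_def proj_id[OF clW[OF i] that] field_simps)
    qed (use Npos onorm_pos_le[OF blQ] in simp)
    then show "1 \<le> onorm (Q i)" using Npos by simp
  qed
  have Q_sum: "((\<lambda>i. (c i * (c i * N i)) *\<^sub>R Q i x) has_sum x) I" for x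
  proof -
    \<comment> \<open>Reconstruction is the series for \<open>?S x\<close> with the bounded operator
      \<open>T\<close> applied termwise.\<close>
    have "((\<lambda>i. T ((c i)\<^sup>2 *\<^sub>R proj (W i) x)) has_sum x) I"
      using has_sum_bounded_linear[OF blT fusion_frame_op_has_sum[OF WB, of x]] by (simp only: TS)
    moreover have "T ((c i)\<^sup>2 *\<^sub>R proj (W i) x) = (c i * (c i * N i)) *\<^sub>R Q i x" if i: "i \<in> I" for i
      using N0[OF i] fusion_sequence_trivial[OF Wf i]
      by (cases "N i = 0")
        (simp_all add: Q_def bounded_op_scaleR[OF T] power2_eq_square linear_0[OF bounded_linear.linear[OF blT]])
    ultimately show ?thesis by (simp cong: has_sum_cong)
  qed
  have "ff_dual_ops I (\<lambda>i. T ` W i) (\<lambda>i. c i * N i) W c Q"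
    unfolding ff_dual_ops_def
  proof (intro conjI ballI allI impI)
    fix i assume i: "i \<in> I"
    show "bounded_op (Q i)" by (rule Q[OF i])
    show "orth_compl (W i) \<subseteq> {x. Q i x = 0}"
      by (auto simp: Q_def proj_orth[OF clW[OF i]] T0)
    show "range (Q i) \<subseteq> T ` W i"
      using subspace_scaleR[OF closed_subspaceD[OF clV[OF i]]] proj_in[OF clW[OF i]]
      by (auto simp: Q_def)
    assume "i \<notin> null_indices I (\<lambda>i. T ` W i) W"
    then show "onorm (Q i) = 1" using i by (intro Q_norm) (auto simp: null_indices_def)
  qed (rule Q_sum)
  then show ?thesis using W VB by (auto simp: ff_dual_def N_def)
qed

end

theorem proposition3p12:
  fixes scale :: "'k::rc_field \<Rightarrow> 'a::banach \<Rightarrow> 'a"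
    and ip :: "'a \<Rightarrow> 'a \<Rightarrow> 'k"
    and I :: "nat set"
    and W :: "nat \<Rightarrow> 'a set"
    and c :: "nat \<Rightarrow> real"
  assumes "hilbert_space scale ip"
    and "hilbert_space.fusion_frame scale ip I W c"
  shows
    \<comment> \<open>(D1)\<close>
    "(\<forall>V d Q. hilbert_space.ff_dual scale ip I V d W c \<longrightarrow>
        hilbert_space.ff_dual_ops scale ip I V d W c Q \<longrightarrow>
        (\<forall>x. ((\<lambda>i. d i *\<^sub>R hilbert_space.proj ip (V i)
                      (Q i (c i *\<^sub>R hilbert_space.proj ip (W i) x))) has_sum x) I)) \<and>
    \<comment> \<open>(D2a)\<close>
     (\<forall>\<phi> \<psi>. hilbert_space.dual_frame scale ip I \<psi> \<phi> \<longrightarrow>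
        hilbert_space.ff_dual scale ip I
          (\<lambda>i. module.span scale {\<psi> i}) (\<lambda>i. norm (\<psi> i))
          (\<lambda>i. module.span scale {\<phi> i}) (\<lambda>i. norm (\<phi> i))) \<and>
    \<comment> \<open>(D2b)\<close>
     (\<forall>V d.
        (\<forall>i\<in>I. hilbert_space.finite_dim scale (W i) \<and> vector_space.dim scale (W i) \<in> {0, 1}) \<longrightarrow>
        hilbert_space.ff_dual scale ip I V d W c \<longrightarrow>
        (\<forall>i\<in>I. hilbert_space.finite_dim scale (V i) \<and> vector_space.dim scale (V i) \<in> {0, 1}) \<longrightarrow>
        (\<exists>\<phi> \<psi>. (\<forall>i\<in>I. \<phi> i \<in> W i \<and> \<psi> i \<in> V i \<and> norm (\<phi> i) = c i \<and> norm (\<psi> i) = d i) \<and>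
          hilbert_space.dual_frame scale ip I \<psi> \<phi>)) \<and>
    \<comment> \<open>(D3)\<close>
     (\<forall>V d. hilbert_space.ff_dual scale ip I V d W c \<longrightarrow>
        hilbert_space.fusion_frame scale ip I V d \<and>
        hilbert_space.ff_dual scale ip I W c V d) \<and>
    \<comment> \<open>(D4)\<close>
     hilbert_space.ff_dual scale ip I
       (\<lambda>i. inv (hilbert_space.fusion_frame_op ip I W c) ` W i)
       (\<lambda>i. c i * onorm_on (inv (hilbert_space.fusion_frame_op ip I W c)) (W i))
       W c"
proof -
  interpret hilbert_space scale ip by (rule assms(1))
  show ?thesis
  proof (intro conjI allI impI)
    fix V d and Q :: "nat \<Rightarrow> 'a \<Rightarrow> 'a" and x
    assume "ff_dual I V d W c" "ff_dual_ops I V d W c Q"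
    then show "((\<lambda>i. d i *\<^sub>R proj (V i) (Q i (c i *\<^sub>R proj (W i) x))) has_sum x) I"
      by (rule ff_dual_reconstruction)
  next
    fix \<phi> \<psi> assume "dual_frame I \<psi> \<phi>"
    then show "ff_dual I (\<lambda>i. span {\<psi> i}) (\<lambda>i. norm (\<psi> i)) (\<lambda>i. span {\<phi> i}) (\<lambda>i. norm (\<phi> i))"
      by (rule dual_frame_ff_dual)
  next
    fix V d assume "\<forall>i\<in>I. finite_dim (W i) \<and> dim (W i) \<in> {0, 1}" "ff_dual I V d W c"
    then show "\<exists>\<phi> \<psi>. (\<forall>i\<in>I. \<phi> i \<in> W i \<and> \<psi> i \<in> V i \<and> norm (\<phi> i) = c i \<and> norm (\<psi> i) = d i) \<and>
        dual_frame I \<psi> \<phi>"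
      by (intro ff_dual_dual_frame) auto
  next
    fix V d assume "ff_dual I V d W c"
    then show "fusion_frame I V d" "ff_dual I W c V d"
      by (rule ff_dual_fusion_frame, rule ff_dual_symmetric)
  next
    show "ff_dual I (\<lambda>i. inv (fusion_frame_op I W c) ` W i)
        (\<lambda>i. c i * onorm_on (inv (fusion_frame_op I W c)) (W i)) W c"
      by (rule canonical_ff_dual) (rule assms(2))
  qed
qed

end
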